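(* Let $T_M>0$, $c>0$, and let $f$ be the solution of $$f''(y)-cf'(y)-f^4(y)=-\int_0^\infty E(y-\eta)f^4(\eta)d\eta\ (y>0),\qquad f(0)=T_M,\qquad f\ge0,$$ obtained by the iterative construction described in the context. Then the limit $f_\infty:=\lim_{y\to\infty}f(y)$ exists and $f_\infty>0$.
   Context: $E(x)=\frac12\int_{|x|}^\infty\frac{e^{-t}}{t}dt$. Iterative construction: $f_0=0$ and, for $n\ge0$, $f_{n+1}$ is the unique minimizer over $\{f\ge0: f\in W^{1,2}(e^{-cy}dy,\mathbb R_+)\cap L^5(e^{-cy}dy,\mathbb R_+),\ f(0)=T_M\}$ of $\int_0^\infty e^{-cy}\big(\frac{(f')^2}{2}+\frac{f^5}{5}+g_nf\big)dy$, $g_n(y)=-\int_0^\infty E(y-\eta)f_n^4(\eta)d\eta$ (so $f_{n+1}''-cf_{n+1}'-f_{n+1}^4=g_n$, $f_{n+1}(0)=T_M$); the sequence is increasing, bounded by $T_M$, and $f=\lim_nf_n$. *)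

theory Defs
  imports "HOL-Analysis.Analysis"
begin

definition Ekern :: "real \<Rightarrow> real" where
  "Ekern x = (1/2) * (LINT t:{\<bar>x\<bar><..}|lborel. exp (- t) / t)"

definition gsrc :: "(real \<Rightarrow> real) \<Rightarrow> real \<Rightarrow> real" where
  "gsrc fn y = - (LINT \<eta>:{0<..}|lborel. Ekern (y - \<eta>) * (fn \<eta>) ^ 4)"

text \<open>Admissible pairs (f, f'): f' is the weak derivative of f on R_+ (f locally
  absolutely continuous with derivative f'), f in W^{1,2}(e^{-cy}dy, R_+) and in
  L^5(e^{-cy}dy, R_+), f >= 0 and f(0) = T.\<close>
definition admissible :: "real \<Rightarrow> real \<Rightarrow> (real \<Rightarrow> real) \<Rightarrow> (real \<Rightarrow> real) \<Rightarrow> bool" where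
  "admissible c T f f' \<longleftrightarrow>
     f 0 = T \<and> (\<forall>y\<ge>0. f y \<ge> 0) \<and>
     (\<forall>y\<ge>0. set_integrable lborel {0..y} f') \<and>
     (\<forall>y\<ge>0. f y = f 0 + (LINT t:{0..y}|lborel. f' t)) \<and>
     set_integrable lborel {0..} (\<lambda>y. exp (- c * y) * (f y)\<^sup>2) \<and>
     set_integrable lborel {0..} (\<lambda>y. exp (- c * y) * (f' y)\<^sup>2) \<and>
     set_integrable lborel {0..} (\<lambda>y. exp (- c * y) * \<bar>f y\<bar> ^ 5)"

definition energy :: "real \<Rightarrow> (real \<Rightarrow> real) \<Rightarrow> (real \<Rightarrow> real) \<Rightarrow> (real \<Rightarrow> real) \<Rightarrow> real" where
  "energy c g f f' =
     (LINT y:{0..}|lborel. exp (- c * y) * ((f' y)\<^sup>2 / 2 + (f y) ^ 5 / 5 + g y * f y))"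

definition is_minimizer :: "real \<Rightarrow> real \<Rightarrow> (real \<Rightarrow> real) \<Rightarrow> (real \<Rightarrow> real) \<Rightarrow> bool" where
  "is_minimizer c T g f \<longleftrightarrow>
     (\<exists>f'. admissible c T f f' \<and>
        (\<forall>h h'. admissible c T h h' \<longrightarrow> energy c g f f' \<le> energy c g h h'))"

end

theory Submission
  imports Defs
begin


text \<open>
  Testing the minimality of \<open>fs (Suc n)\<close> with the Green functions of \<open>f'' - c f'\<close> on intervals
  gives, without any regularity theory, the integral form of the Euler--Lagrange inequality, with
  equality where \<open>fs (Suc n) > 0\<close>. It yields \<open>0 < fs (Suc n) \<le> TM\<close>, and dominated convergence
  turns it into the equation \<open>f'' - c f' = u - E * u\<close> for the limit, where \<open>u\<close> is \<open>f ^ 4\<close> extended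
  by zero.

  Since \<open>E\<close> is an even probability density, \<open>E * u - u\<close> is the second derivative of \<open>K * u\<close> for an
  exponentially decaying \<open>K \<ge> 0\<close>; hence \<open>w = f + K * u\<close> satisfies \<open>w' = c f - A\<close> for a constant
  \<open>A\<close>. Multiplying the equation by \<open>f\<close> and using Young's inequality shows that \<open>f'\<close> is square
  integrable, so \<open>f\<close> and \<open>w\<close> vary slowly at infinity and \<open>f\<close> tends to \<open>A / c\<close>. If \<open>A\<close> were zero,
  \<open>w\<close> would be increasing and tend to zero, although \<open>w 0 \<ge> TM > 0\<close>.
\<close>

text \<open>The constraint \<open>f >= 0\<close> shapes the first half: only upward perturbations
  are always admissible, so minimality gives an inequality, and the equation needs positivity. The
  inequality alone suffices to exclude zeros. For the upper bound the danger is the growing solution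
  \<open>exp (c * y)\<close> of \<open>f'' - c f' = 0\<close>; its square is not integrable against
  \<open>exp (- c * y)\<close>, and this is what rules it out. In the second half boundedness alone
  gives no limit, and neither does square integrability of \<open>f'\<close>. The limit comes from
  the first-order relation for \<open>w\<close>: an increment of \<open>w\<close> over a unit
  interval is an average of \<open>c f - A\<close>, so slow variation forces \<open>c f - A\<close>
  itself to be small. \<open>K\<close> is the twofold antiderivative of \<open>E - \<delta>\<close>;
  it decays at both ends because \<open>E\<close> has mass one and, being even, first moment zero.
  The bound on the integral of \<open>f'\<close> squared is uniform in the length of the interval
  because the weights 1/5 and 4/5 in Young's inequality add up to one, as does the mass of
  \<open>E\<close>, so the two integrals of \<open>f ^ 5\<close> cancel.\<close>

section \<open>The kernel and its potential\<close>

text \<open>\<open>Ekern 0\<close> is the junk value \<open>0\<close> of a divergent integral, whereas \<open>Ekern_nn 0 = \<infinity>\<close>; the two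
  kernels agree almost everywhere.\<close>

definition Ekern_nn :: "real \<Rightarrow> ennreal" where
  "Ekern_nn x = (\<integral>\<^sup>+t. ennreal (indicator {\<bar>x\<bar><..} t * (exp (- t) / (2 * t))) \<partial>lborel)"

lemma indicator_greaterThan_abs_measurable [measurable]:
  "(\<lambda>p::real\<times>real. indicator {\<bar>fst p\<bar><..} (snd p) :: real) \<in> borel_measurable (borel \<Otimes>\<^sub>M borel)"
proof -
  have "(\<lambda>p::real\<times>real. indicator {\<bar>fst p\<bar><..} (snd p) :: real) = (\<lambda>p. if \<bar>fst p\<bar> < snd p then 1 else 0)"
    by (auto simp: indicator_def)
  then show ?thesis by simp
qed

lemma Ekern_nn_measurable [measurable]: "Ekern_nn \<in> borel_measurable lborel"
  unfolding Ekern_nn_def by measurable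

lemma Ekern_eq_enn2real: "Ekern x = enn2real (Ekern_nn x)"
proof -
  have "Ekern x = (LINT t|lborel. indicator {\<bar>x\<bar><..} t * (exp (- t) / (2 * t)))"
    unfolding Ekern_def set_lebesgue_integral_def
    by (subst integral_mult_right_zero [symmetric]) (auto intro!: Bochner_Integration.integral_cong)
  also have "\<dots> = enn2real (Ekern_nn x)"
    unfolding Ekern_nn_def
    by (intro integral_eq_nn_integral) (auto simp: indicator_def intro!: AE_I2)
  finally show ?thesis .
qed

lemma Ekern_nonneg: "0 \<le> Ekern x"
  by (simp add: Ekern_eq_enn2real)

lemma Ekern_even: "Ekern (- x) = Ekern x"
  by (simp add: Ekern_def)

lemma Ekern_measurable [measurable]: "Ekern \<in> borel_measurable borel"
proof -
  have "Ekern = (\<lambda>x. enn2real (Ekern_nn x))" by (auto simp: Ekern_eq_enn2real)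
  also have "\<dots> \<in> borel_measurable borel" using Ekern_nn_measurable by simp
  finally show ?thesis .
qed

text \<open>Tonelli: for fixed \<open>t > 0\<close> the condition \<open>\<bar>z\<bar> < t\<close>
  cuts out an interval. Its full length \<open>2 * t\<close> cancels the denominator, which is how
  total mass and tails of the kernel become integrals of \<open>exp (- t)\<close>.\<close>

lemma nn_integral_Ekern_nn:
  assumes [measurable]: "A \<in> sets borel"
  shows "(\<integral>\<^sup>+z. Ekern_nn z * indicator A z \<partial>lborel) =
    (\<integral>\<^sup>+t. ennreal (indicator {0<..} t * (exp (- t) / (2 * t))) * emeasure lborel (A \<inter> {-t<..<t}) \<partial>lborel)"
proof -
  have "(\<integral>\<^sup>+z. Ekern_nn z * indicator A z \<partial>lborel) =
      (\<integral>\<^sup>+z. (\<integral>\<^sup>+t. ennreal (indicator {\<bar>z\<bar><..} t * (exp (- t) / (2 * t))) * indicator A z \<partial>lborel) \<partial>lborel)"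
    unfolding Ekern_nn_def by (intro nn_integral_cong nn_integral_multc [symmetric]) auto
  also have "\<dots> = (\<integral>\<^sup>+t. (\<integral>\<^sup>+z. ennreal (indicator {\<bar>z\<bar><..} t * (exp (- t) / (2 * t))) * indicator A z \<partial>lborel) \<partial>lborel)"
    by (rule lborel_pair.Fubini'[symmetric]) measurable
  also have "\<dots> = (\<integral>\<^sup>+t. (\<integral>\<^sup>+z. ennreal (indicator {0<..} t * (exp (- t) / (2 * t))) * indicator (A \<inter> {-t<..<t}) z \<partial>lborel) \<partial>lborel)"
    by (intro nn_integral_cong) (auto simp: indicator_def)
  also have "\<dots> = (\<integral>\<^sup>+t. ennreal (indicator {0<..} t * (exp (- t) / (2 * t))) * emeasure lborel (A \<inter> {-t<..<t}) \<partial>lborel)"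
    by (intro nn_integral_cong) (simp add: nn_integral_cmult_indicator)
  finally show ?thesis .
qed

lemma nn_integral_exp_tail:
  fixes x :: real
  shows "(\<integral>\<^sup>+t. ennreal (exp (- t)) * indicator {x..} t \<partial>lborel) = ennreal (exp (- x))"
proof -
  have "((\<lambda>t::real. - exp (- t)) \<longlongrightarrow> 0) at_top"
    by (rule tendsto_eq_intros filterlim_compose[OF exp_at_bot] filterlim_uminus_at_bot_at_top | simp)+
  then have "(\<integral>\<^sup>+t. ennreal (exp (- t)) * indicator {x..} t \<partial>lborel) = ennreal (0 - (- exp (- x)))"
    by (intro nn_integral_FTC_atLeast) (auto intro!: derivative_eq_intros)
  then show ?thesis by simp
qed

lemma nn_integral_Ekern_nn_UNIV: "(\<integral>\<^sup>+z. Ekern_nn z \<partial>lborel) = 1"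
proof -
  have "(\<integral>\<^sup>+z. Ekern_nn z \<partial>lborel) = (\<integral>\<^sup>+z. Ekern_nn z * indicator UNIV z \<partial>lborel)" by simp
  also have "\<dots> = (\<integral>\<^sup>+t. ennreal (indicator {0<..} t * (exp (- t) / (2 * t))) * emeasure lborel (UNIV \<inter> {-t<..<t}) \<partial>lborel)"
    by (rule nn_integral_Ekern_nn) simp
  also have "\<dots> = (\<integral>\<^sup>+t. ennreal (exp (- t)) * indicator {0..} t \<partial>lborel)"
  proof (intro nn_integral_cong_AE)
    have "AE t in lborel. t \<noteq> (0::real)" by (rule AE_lborel_singleton)
    then show "AE t in lborel. ennreal (indicator {0<..} t * (exp (- t) / (2 * t))) * emeasure lborel (UNIV \<inter> {-t<..<t})
       = ennreal (exp (- t)) * indicator {0..} t"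
    proof eventually_elim
      case (elim t)
      then show ?case
        by (cases "t > 0") (auto simp: indicator_def ennreal_mult[symmetric])
    qed
  qed
  also have "\<dots> = 1" by (simp add: nn_integral_exp_tail)
  finally show ?thesis .
qed

lemma AE_ennreal_Ekern: "AE z in lborel. ennreal (Ekern z) = Ekern_nn z"
proof -
  have "AE z in lborel. Ekern_nn z \<noteq> \<infinity>"
    by (rule nn_integral_PInf_AE) (auto simp: nn_integral_Ekern_nn_UNIV)
  then show ?thesis
    by eventually_elim (auto simp: Ekern_eq_enn2real less_top)
qed

lemma nn_integral_Ekern: "(\<integral>\<^sup>+z. ennreal (Ekern z) \<partial>lborel) = 1"
  using nn_integral_cong_AE[OF AE_ennreal_Ekern] nn_integral_Ekern_nn_UNIV by simp

lemma Ekern_integrable: "integrable lborel Ekern"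
  by (rule integrableI_nonneg) (auto simp: Ekern_nonneg nn_integral_Ekern)

lemma integral_Ekern: "(LINT z|lborel. Ekern z) = 1"
  by (subst integral_eq_nn_integral) (auto simp: Ekern_nonneg nn_integral_Ekern)

text \<open>At level \<open>t > x\<close> the slice beyond \<open>x\<close> has length
  \<open>t - x <= t\<close>, so the factor \<open>1 / (2 * t)\<close> leaves at most
  \<open>exp (- t) / 2\<close>, to be integrated over \<open>t >= x\<close>.\<close>

lemma Ekern_tail_le:
  assumes "0 \<le> x"
  shows "(LINT z:{x<..}|lborel. Ekern z) \<le> exp (- x) / 2"
proof -
  have "(\<integral>\<^sup>+z. ennreal (Ekern z) * indicator {x<..} z \<partial>lborel) = (\<integral>\<^sup>+z. Ekern_nn z * indicator {x<..} z \<partial>lborel)"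
    by (rule nn_integral_cong_AE) (use AE_ennreal_Ekern in eventually_elim, simp)
  also have "\<dots> = (\<integral>\<^sup>+t. ennreal (indicator {0<..} t * (exp (- t) / (2 * t))) * emeasure lborel ({x<..} \<inter> {-t<..<t}) \<partial>lborel)"
    by (rule nn_integral_Ekern_nn) simp
  also have "\<dots> \<le> (\<integral>\<^sup>+t. ennreal (1/2) * (ennreal (exp (- t)) * indicator {x..} t) \<partial>lborel)"
  proof (intro nn_integral_mono)
    fix t :: real
    show "ennreal (indicator {0<..} t * (exp (- t) / (2 * t))) * emeasure lborel ({x<..} \<inter> {-t<..<t})
      \<le> ennreal (1/2) * (ennreal (exp (- t)) * indicator {x..} t)"
    proof (cases "t > x")
      case True
      then have "{x<..} \<inter> {-t<..<t} = {x<..<t}" using assms by auto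
      moreover have *: "exp (-t) / (2*t) * (t - x) \<le> 1/2 * exp (-t)"
        using True assms by (simp add: field_simps)
      ultimately have "ennreal (indicator {0<..} t * (exp (- t) / (2 * t))) * emeasure lborel ({x<..} \<inter> {-t<..<t})
          = ennreal (exp (- t) / (2 * t) * (t - x))"
        using True assms by (simp add: ennreal_mult[symmetric])
      also have "\<dots> \<le> ennreal (1/2 * exp (- t))" by (rule ennreal_leI) (fact *)
      also have "\<dots> = ennreal (1/2) * (ennreal (exp (- t)) * indicator {x..} t)"
        using True by (subst ennreal_mult) auto
      finally show ?thesis .
    next
      case False
      then have e: "{x<..} \<inter> {-t<..<t} = {}" by auto
      show ?thesis unfolding e by simp
    qed
  qed
  also have "\<dots> = ennreal (1/2) * ennreal (exp (- x))"
    by (subst nn_integral_cmult) (auto simp: nn_integral_exp_tail)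
  also have "\<dots> = ennreal (exp (- x) / 2)" by (subst ennreal_mult[symmetric]) auto
  finally have le: "(\<integral>\<^sup>+z. ennreal (Ekern z) * indicator {x<..} z \<partial>lborel) \<le> ennreal (exp (- x) / 2)" .
  have "(LINT z:{x<..}|lborel. Ekern z) = enn2real (\<integral>\<^sup>+z. ennreal (indicator {x<..} z * Ekern z) \<partial>lborel)"
    unfolding set_lebesgue_integral_def
    by (subst integral_eq_nn_integral) (auto simp: Ekern_nonneg)
  also have "(\<lambda>z. ennreal (indicator {x<..} z * Ekern z)) = (\<lambda>z. ennreal (Ekern z) * indicator {x<..} z)"
    by (auto simp: indicator_def)
  also have "enn2real (\<integral>\<^sup>+z. ennreal (Ekern z) * indicator {x<..} z \<partial>lborel) \<le> exp (- x) / 2"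
    using enn2real_mono[OF le] by simp
  finally show ?thesis .
qed


section \<open>Distribution functions and the two successive antiderivatives of the kernel\<close>

lemma borel_measurable_cdf:
  fixes k :: "real \<Rightarrow> real"
  assumes [measurable]: "k \<in> borel_measurable borel"
  shows "(\<lambda>x. LINT z:{..x}|lborel. k z) \<in> borel_measurable borel"
proof -
  have "(\<lambda>x. LINT z:{..x}|lborel. k z) = (\<lambda>x. LINT z|lborel. (if z \<le> x then 1 else 0) * k z)"
    unfolding set_lebesgue_integral_def
    by (auto intro!: Bochner_Integration.integral_cong simp: indicator_def)
  also have "\<dots> \<in> borel_measurable borel" by measurable
  finally show ?thesis .
qed

lemma integrable_indicator_mult:
  fixes k :: "real \<Rightarrow> real"
  assumes "integrable lborel k" "A \<in> sets borel"
  shows "integrable lborel (\<lambda>x. indicator A x * k x)"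
  using integrable_mult_indicator[of A lborel k] assms by simp

lemma cdf_diff:
  fixes k :: "real \<Rightarrow> real"
  assumes k: "integrable lborel k" and "a \<le> b"
  shows "(LINT z:{..b}|lborel. k z) - (LINT z:{..a}|lborel. k z) = (LINT z:{a..b}|lborel. k z)"
proof -
  have [measurable]: "k \<in> borel_measurable borel" using k by auto
  have "(LINT z:{..b}|lborel. k z) - (LINT z:{..a}|lborel. k z)
      = (LINT z|lborel. indicator {..b} z * k z - indicator {..a} z * k z)"
    unfolding set_lebesgue_integral_def
    by (simp add: Bochner_Integration.integral_diff integrable_indicator_mult k)
  also have "\<dots> = (LINT z|lborel. indicator {a..b} z * k z)"
  proof (intro integral_cong_AE)
    have "AE z in lborel. z \<noteq> a" by (rule AE_lborel_singleton)
    then show "AE z in lborel. indicator {..b} z * k z - indicator {..a} z * k z = indicator {a..b} z * k z"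
      by eventually_elim (use \<open>a \<le> b\<close> in \<open>auto simp: indicator_def\<close>)
  qed auto
  finally show ?thesis by (simp add: set_lebesgue_integral_def)
qed

lemma cdf_compl:
  fixes k :: "real \<Rightarrow> real"
  assumes k: "integrable lborel k"
  shows "(LINT z:{..x}|lborel. k z) + (LINT z:{x<..}|lborel. k z) = (LINT z|lborel. k z)"
proof -
  have "(LINT z:{..x}|lborel. k z) + (LINT z:{x<..}|lborel. k z)
      = (LINT z|lborel. indicator {..x} z * k z + indicator {x<..} z * k z)"
    unfolding set_lebesgue_integral_def
    by (simp add: Bochner_Integration.integral_add integrable_indicator_mult k)
  also have "\<dots> = (LINT z|lborel. k z)"
    by (intro Bochner_Integration.integral_cong) (auto simp: indicator_def)
  finally show ?thesis .
qed

lemma cdf_reflect: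
  fixes k :: "real \<Rightarrow> real"
  assumes [measurable]: "k \<in> borel_measurable borel"
  shows "(LINT z:{..-x}|lborel. k z) = (LINT z:{x<..}|lborel. k (- z))"
proof -
  have "(LINT z:{..-x}|lborel. k z) = (LINT z:{z. - z \<in> {..-x}}|lborel. k (- z))"
    by (rule set_integral_reflect)
  also have "\<dots> = (LINT z:{x<..}|lborel. k (- z))"
    unfolding set_lebesgue_integral_def
  proof (intro integral_cong_AE)
    have "AE z in lborel. z \<noteq> x" by (rule AE_lborel_singleton)
    then show "AE z in lborel. indicat_real {z. - z \<in> {..-x}} z *\<^sub>R k (- z) = indicat_real {x<..} z *\<^sub>R k (- z)"
      by eventually_elim (auto simp: indicator_def)
  qed auto
  finally show ?thesis .
qed

lemma integrable_exp_neg_abs: "integrable lborel (\<lambda>x::real. exp (- \<bar>x\<bar>))"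
proof -
  have 1: "integrable lborel (\<lambda>t::real. indicator {0..} t * exp (- t))"
  proof (rule integrableI_nonneg)
    have "(\<integral>\<^sup>+t. ennreal (indicator {0..} t * exp (- t)) \<partial>lborel) = (\<integral>\<^sup>+t. ennreal (exp (- t)) * indicator {0..} t \<partial>lborel)"
      by (intro nn_integral_cong) (auto simp: indicator_def)
    then show "(\<integral>\<^sup>+t. ennreal (indicator {0..} t * exp (- t)) \<partial>lborel) < \<infinity>"
      unfolding nn_integral_exp_tail by simp
  qed auto
  have 2: "integrable lborel (\<lambda>t::real. indicator {0..} (0 + (-1) * t) * exp (- (0 + (-1) * t)))"
    using lborel_integrable_real_affine[OF 1, of "-1" 0] by simp
  show ?thesis
    by (rule Bochner_Integration.integrable_bound[OF Bochner_Integration.integrable_add[OF 1 2]])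
       (auto simp: indicator_def)
qed

text \<open>\<open>Epot' = Eflux\<close> and, in the sense of distributions, \<open>Eflux' = Ekern - \<delta>\<close>.\<close>

definition Ecdf :: "real \<Rightarrow> real" where "Ecdf x = (LINT z:{..x}|lborel. Ekern z)"
definition Eflux :: "real \<Rightarrow> real" where "Eflux x = Ecdf x - indicator {0<..} x"
definition Epot :: "real \<Rightarrow> real" where "Epot x = (LINT z:{..x}|lborel. Eflux z)"

lemma Ecdf_measurable [measurable]: "Ecdf \<in> borel_measurable borel"
  unfolding Ecdf_def[abs_def] by (rule borel_measurable_cdf) measurable

lemma Eflux_measurable [measurable]: "Eflux \<in> borel_measurable borel"
  unfolding Eflux_def[abs_def] by measurable

lemma Epot_measurable [measurable]: "Epot \<in> borel_measurable borel"
  unfolding Epot_def[abs_def] by (rule borel_measurable_cdf) measurable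

lemma Ecdf_minus: "Ecdf (- x) = 1 - Ecdf x"
  using cdf_reflect[of Ekern x] cdf_compl[OF Ekern_integrable, of x]
  by (simp add: Ecdf_def Ekern_even integral_Ekern)

text \<open>The origin is excluded because the jump is placed to its right:
  \<open>Ecdf 0 = 1/2\<close> by symmetry, hence \<open>Eflux 0 = 1/2\<close>.\<close>

lemma Eflux_odd: "x \<noteq> 0 \<Longrightarrow> Eflux (- x) = - Eflux x"
  by (auto simp: Eflux_def Ecdf_minus indicator_def)

lemma Eflux_nonpos_bounds:
  assumes "x \<le> 0" shows "0 \<le> Eflux x" "Eflux x \<le> exp x"
proof -
  have "Eflux x = (LINT z:{-x<..}|lborel. Ekern z)"
    using assms cdf_reflect[of Ekern "-x"] by (simp add: Eflux_def Ecdf_def Ekern_even)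
  moreover have "\<dots> \<le> exp x / 2" using Ekern_tail_le[of "-x"] assms by simp
  moreover have "0 \<le> (LINT z:{-x<..}|lborel. Ekern z)"
    unfolding set_lebesgue_integral_def by (intro Bochner_Integration.integral_nonneg) (simp add: Ekern_nonneg)
  moreover have "exp x / 2 \<le> exp x" by simp
  ultimately show "0 \<le> Eflux x" "Eflux x \<le> exp x" by linarith+
qed

lemma Eflux_abs_le: "\<bar>Eflux x\<bar> \<le> exp (- \<bar>x\<bar>)"
proof (cases "x \<le> 0")
  case True
  then show ?thesis using Eflux_nonpos_bounds[OF True] by simp
next
  case False
  then show ?thesis using Eflux_nonpos_bounds[of "-x"] Eflux_odd[of x] by simp
qed

lemma Eflux_integrable: "integrable lborel Eflux"
  by (rule Bochner_Integration.integrable_bound[OF integrable_exp_neg_abs]) (auto simp: Eflux_abs_le)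

text \<open>Oddness almost everywhere. The vanishing integral makes \<open>Epot\<close> tend to zero
  at plus infinity as well.\<close>

lemma integral_Eflux: "(LINT z|lborel. Eflux z) = 0"
proof -
  have "(LINT z|lborel. Eflux z) = (LINT z|lborel. Eflux (- z))"
    using lborel_integral_real_affine[of "-1" Eflux 0] by simp
  also have "\<dots> = (LINT z|lborel. - Eflux z)"
  proof (intro integral_cong_AE)
    have "AE z in lborel. z \<noteq> (0::real)" by (rule AE_lborel_singleton)
    then show "AE z in lborel. Eflux (- z) = - Eflux z"
      by eventually_elim (rule Eflux_odd)
  qed auto
  finally show ?thesis by simp
qed

lemma Epot_even: "Epot (- x) = Epot x"
proof -
  have "Epot (- x) = (LINT z:{x<..}|lborel. Eflux (- z))"
    using cdf_reflect[of Eflux x] by (simp add: Epot_def)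
  also have "\<dots> = (LINT z:{x<..}|lborel. - Eflux z)"
    unfolding set_lebesgue_integral_def
  proof (intro integral_cong_AE)
    have "AE z in lborel. z \<noteq> (0::real)" by (rule AE_lborel_singleton)
    then show "AE z in lborel. indicat_real {x<..} z *\<^sub>R Eflux (- z) = indicat_real {x<..} z *\<^sub>R - Eflux z"
      by eventually_elim (simp add: Eflux_odd)
  qed auto
  also have "\<dots> = - (LINT z:{x<..}|lborel. Eflux z)"
    by (simp add: set_lebesgue_integral_def)
  also have "\<dots> = Epot x"
    using cdf_compl[OF Eflux_integrable, of x] by (simp add: integral_Eflux Epot_def)
  finally show ?thesis .
qed

lemma Epot_nonpos_bounds:
  assumes "x \<le> 0" shows "0 \<le> Epot x" "Epot x \<le> exp x"
proof -
  show "0 \<le> Epot x"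
    unfolding Epot_def set_lebesgue_integral_def
    by (intro Bochner_Integration.integral_nonneg) (use assms in \<open>auto simp: indicator_def Eflux_nonpos_bounds\<close>)
  have "Epot x = enn2real (\<integral>\<^sup>+z. ennreal (indicator {..x} z * Eflux z) \<partial>lborel)"
    unfolding Epot_def set_lebesgue_integral_def
    by (subst integral_eq_nn_integral) (use assms in \<open>auto simp: indicator_def Eflux_nonpos_bounds\<close>)
  also have "\<dots> \<le> exp x"
  proof -
    have "(\<integral>\<^sup>+z. ennreal (indicator {..x} z * Eflux z) \<partial>lborel) \<le> (\<integral>\<^sup>+z. ennreal (exp z) * indicator {..x} z \<partial>lborel)"
      by (intro nn_integral_mono)
        (use assms Eflux_nonpos_bounds(2) in \<open>auto simp: indicator_def intro!: ennreal_leI\<close>)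
    also have "\<dots> = (\<integral>\<^sup>+z. ennreal (exp (- z)) * indicator {..x} (- z) \<partial>lborel)"
      by (subst nn_integral_real_affine[where c="-1" and t=0]) auto
    also have "\<dots> = (\<integral>\<^sup>+z. ennreal (exp (- z)) * indicator {-x..} z \<partial>lborel)"
      by (intro nn_integral_cong) (auto simp: indicator_def)
    also have "\<dots> = ennreal (exp x)" by (simp add: nn_integral_exp_tail)
    finally show ?thesis by (metis enn2real_mono enn2real_ennreal ennreal_less_top exp_ge_zero)
  qed
  finally show "Epot x \<le> exp x" .
qed

text \<open>To the right of 0 the integrand \<open>Eflux\<close> is negative or zero, so sign and
  decay are not visible from the defining integral there; evenness transfers them from the left
  half-line.\<close>

lemma Epot_nonneg: "0 \<le> Epot x" and Epot_le: "Epot x \<le> exp (- \<bar>x\<bar>)"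
proof -
  have "Epot x = Epot (- \<bar>x\<bar>)" by (auto simp: abs_if Epot_even)
  then show "0 \<le> Epot x" "Epot x \<le> exp (- \<bar>x\<bar>)"
    using Epot_nonpos_bounds[of "- \<bar>x\<bar>"] by auto
qed

lemma Epot_integrable: "integrable lborel Epot"
  by (rule Bochner_Integration.integrable_bound[OF integrable_exp_neg_abs]) (auto simp: Epot_nonneg Epot_le)

section \<open>Convolution of an integrable kernel with a bounded function\<close>

definition conv :: "(real \<Rightarrow> real) \<Rightarrow> (real \<Rightarrow> real) \<Rightarrow> real \<Rightarrow> real" where
  "conv k u y = (LINT \<eta>|lborel. k (y - \<eta>) * u \<eta>)"

lemma conv_commute: "conv k u y = (LINT x|lborel. k x * u (y - x))"
  unfolding conv_def by (subst lborel_integral_real_affine[where c="-1" and t=y]) auto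

lemma integrable_indicator_Icc: "integrable lborel (\<lambda>y. indicator {a..b::real} y *\<^sub>R (C::real))"
  by (intro integrable_scaleR_left integrable_real_indicator) (auto simp: emeasure_lborel_Icc_eq)

lemma conv_integrable:
  fixes k u :: "real \<Rightarrow> real"
  assumes k: "integrable lborel k" and [measurable]: "u \<in> borel_measurable borel" and u: "\<And>x. \<bar>u x\<bar> \<le> B"
  shows "integrable lborel (\<lambda>\<eta>. k (y - \<eta>) * u \<eta>)" "integrable lborel (\<lambda>x. k x * u (y - x))"
proof -
  have [measurable]: "k \<in> borel_measurable borel" using k by auto
  have b: "integrable lborel (\<lambda>\<eta>. k (y - \<eta>))"
    using lborel_integrable_real_affine[OF k, of "-1" y] by simp
  show "integrable lborel (\<lambda>\<eta>. k (y - \<eta>) * u \<eta>)"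
    by (rule Bochner_Integration.integrable_bound[OF integrable_mult_right[OF b, of B]])
       (auto simp: abs_mult mult.commute intro!: AE_I2 mult_right_mono order_trans[OF u abs_ge_self])
  show "integrable lborel (\<lambda>x. k x * u (y - x))"
    by (rule Bochner_Integration.integrable_bound[OF integrable_mult_right[OF k, of B]])
       (auto simp: abs_mult mult.commute[of "\<bar>B\<bar>"] intro!: AE_I2 mult_left_mono order_trans[OF u abs_ge_self])
qed

lemma conv_measurable [measurable]:
  assumes [measurable]: "k \<in> borel_measurable borel" "u \<in> borel_measurable borel"
  shows "conv k u \<in> borel_measurable borel"
  unfolding conv_def[abs_def] by measurable

lemma conv_abs_le:
  assumes k: "integrable lborel k" and [measurable]: "u \<in> borel_measurable borel" and u: "\<And>x. \<bar>u x\<bar> \<le> B"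
  shows "\<bar>conv k u y\<bar> \<le> B * (LINT x|lborel. \<bar>k x\<bar>)"
proof -
  have "\<bar>conv k u y\<bar> \<le> (LINT x|lborel. \<bar>k x * u (y - x)\<bar>)"
    unfolding conv_commute using integral_norm_bound[of lborel "\<lambda>x. k x * u (y - x)"] by simp
  also have "\<dots> \<le> (LINT x|lborel. B * \<bar>k x\<bar>)"
    using k conv_integrable(2)[OF assms, of y]
    by (intro integral_mono integrable_abs integrable_mult_right)
       (auto simp: abs_mult mult.commute[of B] intro!: mult_left_mono u)
  finally show ?thesis by simp
qed

lemma conv_mono:
  assumes k: "integrable lborel k" "\<And>x. 0 \<le> k x"
    and "u \<in> borel_measurable borel" "\<And>x. \<bar>u x\<bar> \<le> B"
    and "v \<in> borel_measurable borel" "\<And>x. \<bar>v x\<bar> \<le> B" "\<And>x. u x \<le> v x"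
  shows "conv k u y \<le> conv k v y"
  unfolding conv_def using conv_integrable(1)[OF k(1) assms(3,4)] conv_integrable(1)[OF k(1) assms(5,6)]
  by (intro integral_mono mult_left_mono assms) auto

lemma conv_const: "conv k (\<lambda>_. B) y = B * (LINT x|lborel. k x)"
  by (simp add: conv_commute)

text \<open>Fubini on a bounded window, where boundedness of \<open>u\<close> makes the double
  integral absolutely convergent. Moving the window integral onto the kernel produces differences of
  its distribution function.\<close>

lemma integral_conv:
  assumes k: "integrable lborel k" and [measurable]: "u \<in> borel_measurable borel" and u: "\<And>x. \<bar>u x\<bar> \<le> B"
  shows "(LINT y:{a..b}|lborel. conv k u y) = (LINT \<eta>|lborel. (LINT y:{a..b}|lborel. k (y - \<eta>)) * u \<eta>)"
proof -
  have [measurable]: "k \<in> borel_measurable borel" using k by auto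
  let ?F = "\<lambda>(y, \<eta>). indicator {a..b} y * (k (y - \<eta>) * u \<eta>)"
  have int: "integrable (lborel \<Otimes>\<^sub>M lborel) ?F"
  proof (rule lborel_pair.Fubini_integrable)
    show "?F \<in> borel_measurable (lborel \<Otimes>\<^sub>M lborel)" by measurable
    show "AE y in lborel. integrable lborel (\<lambda>\<eta>. ?F (y, \<eta>))"
      using conv_integrable(1)[OF assms] by auto
    have eq: "(\<lambda>y. LINT \<eta>|lborel. norm (?F (y, \<eta>))) = (\<lambda>y. indicator {a..b} y * conv (\<lambda>x. \<bar>k x\<bar>) (\<lambda>x. \<bar>u x\<bar>) y)"
      by (auto simp: conv_def abs_mult indicator_def fun_eq_iff)
    show "integrable lborel (\<lambda>y. LINT \<eta>|lborel. norm (?F (y, \<eta>)))"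
      unfolding eq
    proof (rule Bochner_Integration.integrable_bound)
      show "integrable lborel (\<lambda>y. indicator {a..b} y *\<^sub>R (B * (LINT x|lborel. \<bar>k x\<bar>)))" by (rule integrable_indicator_Icc)
      show "AE y in lborel. norm (indicator {a..b} y * conv (\<lambda>x. \<bar>k x\<bar>) (\<lambda>x. \<bar>u x\<bar>) y)
          \<le> norm (indicator {a..b} y *\<^sub>R (B * (LINT x|lborel. \<bar>k x\<bar>)))"
        using conv_abs_le[of "\<lambda>x. \<bar>k x\<bar>" "\<lambda>x. \<bar>u x\<bar>" B] k u
        by (auto simp: indicator_def intro!: AE_I2 order_trans[OF _ abs_ge_self])
    qed measurable
  qed
  have "(LINT y:{a..b}|lborel. conv k u y) = (LINT y|lborel. LINT \<eta>|lborel. ?F (y, \<eta>))"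
    by (simp add: set_lebesgue_integral_def conv_def)
  also have "\<dots> = (LINT \<eta>|lborel. LINT y|lborel. ?F (y, \<eta>))"
    using lborel_pair.Fubini_integral[of "\<lambda>y \<eta>. ?F (y, \<eta>)"] int by (simp add: case_prod_unfold)
  also have "\<dots> = (LINT \<eta>|lborel. (LINT y:{a..b}|lborel. k (y - \<eta>)) * u \<eta>)"
    unfolding set_lebesgue_integral_def
    by (intro Bochner_Integration.integral_cong refl)
       (simp add: integral_mult_left_zero[symmetric] mult.assoc[symmetric] del: integral_mult_left_zero)
  finally show ?thesis .
qed

lemma set_integral_shift:
  fixes k :: "real \<Rightarrow> real"
  shows "(LINT y:{a..b}|lborel. k (y - \<eta>)) = (LINT z:{a-\<eta>..b-\<eta>}|lborel. k z)"
proof -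
  have "(LINT z:{a-\<eta>..b-\<eta>}|lborel. k z) = (LINT y|lborel. indicator {a-\<eta>..b-\<eta>} (-\<eta> + 1 * y) *\<^sub>R k (-\<eta> + 1 * y))"
    unfolding set_lebesgue_integral_def
    by (subst lborel_integral_real_affine[where c=1 and t="-\<eta>"]) simp_all
  also have "\<dots> = (LINT y:{a..b}|lborel. k (y - \<eta>))"
    unfolding set_lebesgue_integral_def
    by (intro Bochner_Integration.integral_cong) (auto simp: indicator_def)
  finally show ?thesis by simp
qed

text \<open>Integral form of \<open>(Epot * u)' = Eflux * u\<close>, which avoids differentiating
  under the integral sign.\<close>

lemma conv_Epot_diff:
  assumes [measurable]: "u \<in> borel_measurable borel" and u: "\<And>x. \<bar>u x\<bar> \<le> B" and "a \<le> b"
  shows "conv Epot u b - conv Epot u a = (LINT y:{a..b}|lborel. conv Eflux u y)"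
proof -
  have "(LINT y:{a..b}|lborel. conv Eflux u y) = (LINT \<eta>|lborel. (Epot (b - \<eta>) - Epot (a - \<eta>)) * u \<eta>)"
    unfolding integral_conv[OF Eflux_integrable assms(1,2)] set_integral_shift
    using \<open>a \<le> b\<close> by (simp add: Epot_def cdf_diff[OF Eflux_integrable])
  also have "\<dots> = (LINT \<eta>|lborel. Epot (b - \<eta>) * u \<eta> - Epot (a - \<eta>) * u \<eta>)"
    by (simp add: left_diff_distrib)
  also have "\<dots> = conv Epot u b - conv Epot u a"
    unfolding conv_def by (intro Bochner_Integration.integral_diff conv_integrable(1)[OF Epot_integrable assms(1,2)])
  finally show ?thesis ..
qed

text \<open>Integral form of \<open>(Eflux * u)' = Ekern * u - u\<close>; the jump of
  \<open>Eflux\<close> at the origin is the source of the local term.\<close>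

lemma conv_Eflux_diff:
  assumes [measurable]: "u \<in> borel_measurable borel" and u: "\<And>x. \<bar>u x\<bar> \<le> B" and "a \<le> b"
  shows "conv Eflux u b - conv Eflux u a = (LINT y:{a..b}|lborel. conv Ekern u y) - (LINT y:{a..b}|lborel. u y)"
proof -
  have i: "integrable lborel (\<lambda>\<eta>. indicator {a..b} \<eta> * u \<eta>)"
  proof (rule Bochner_Integration.integrable_bound)
    show "integrable lborel (\<lambda>y. indicator {a..b} y *\<^sub>R B)" by (rule integrable_indicator_Icc)
    show "AE y in lborel. norm (indicator {a..b} y * u y) \<le> norm (indicator {a..b} y *\<^sub>R B)"
      using u by (auto simp: indicator_def intro!: AE_I2 order_trans[OF _ abs_ge_self])
  qed measurable
  have "(LINT y:{a..b}|lborel. conv Ekern u y) = (LINT \<eta>|lborel. (Ecdf (b - \<eta>) - Ecdf (a - \<eta>)) * u \<eta>)"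
    unfolding integral_conv[OF Ekern_integrable assms(1,2)] set_integral_shift
    using \<open>a \<le> b\<close> by (simp add: Ecdf_def cdf_diff[OF Ekern_integrable])
  also have "\<dots> = (LINT \<eta>|lborel. (Eflux (b - \<eta>) * u \<eta> - Eflux (a - \<eta>) * u \<eta>) + indicator {a..b} \<eta> * u \<eta>)"
  proof (intro integral_cong_AE)
    \<comment> \<open>The two jump terms combine to the indicator of \<open>{a..<b}\<close>, which
      differs from that of \<open>{a..b}\<close> only at an endpoint.\<close>
    have "AE z in lborel. z \<noteq> a" "AE z in lborel. z \<noteq> b" by (rule AE_lborel_singleton)+
    then show "AE \<eta> in lborel. (Ecdf (b - \<eta>) - Ecdf (a - \<eta>)) * u \<eta>
        = (Eflux (b - \<eta>) * u \<eta> - Eflux (a - \<eta>) * u \<eta>) + indicator {a..b} \<eta> * u \<eta>"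
      by eventually_elim (use \<open>a \<le> b\<close> in \<open>auto simp: Eflux_def indicator_def algebra_simps\<close>)
  qed measurable
  also have "\<dots> = (conv Eflux u b - conv Eflux u a) + (LINT y:{a..b}|lborel. u y)"
    unfolding conv_def set_lebesgue_integral_def
    using conv_integrable(1)[OF Eflux_integrable assms(1,2)] i
    by (simp add: Bochner_Integration.integral_add Bochner_Integration.integral_diff)
  finally show ?thesis by simp
qed


section \<open>First variation of the energy\<close>

lemma continuous_on_atLeast_0I:
  fixes f :: "real \<Rightarrow> real"
  assumes "\<And>R. 0 < R \<Longrightarrow> continuous_on {0..R} f"
  shows "continuous_on {0..} f"
  unfolding continuous_on_eq_continuous_within
proof
  fix x :: real assume "x \<in> {0..}"
  then have "continuous (at x within {0..x+1}) f"
    using assms[of "x+1"] by (auto simp: continuous_on_eq_continuous_within)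
  moreover have "at x within {0..x+1} = at x within {0..}"
    by (rule at_within_nhd[where S="{x-1<..<x+1}"]) auto
  ultimately show "continuous (at x within {0..}) f" by simp
qed

lemma admissibleD:
  assumes "admissible c T f f'"
  shows "f 0 = T" "\<And>y. 0 \<le> y \<Longrightarrow> 0 \<le> f y"
    "\<And>y. 0 \<le> y \<Longrightarrow> set_integrable lborel {0..y} f'"
    "\<And>y. 0 \<le> y \<Longrightarrow> f y = f 0 + (LINT t:{0..y}|lborel. f' t)"
    "set_integrable lborel {0..} (\<lambda>y. exp (- c * y) * (f y)\<^sup>2)"
    "set_integrable lborel {0..} (\<lambda>y. exp (- c * y) * (f' y)\<^sup>2)"
    "set_integrable lborel {0..} (\<lambda>y. exp (- c * y) * \<bar>f y\<bar> ^ 5)"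
  using assms unfolding admissible_def by - (elim conjE, assumption | elim conjE, erule allE, erule (1) mp)+

lemma admissible_diff:
  assumes adm: "admissible c T f f'" and "0 \<le> a" "a \<le> b"
  shows "(LINT t:{a..b}|lborel. f' t) = f b - f a"
proof -
  have 0: "set_integrable lborel {0..b} f'" "set_integrable lborel {0..a} f'"
    using assms by (auto intro: admissibleD(3)[OF adm])
  have 1: "set_integrable lborel {a..b} f'"
    by (rule set_integrable_subset[OF 0(1)]) (use assms in auto)
  have "f b = f 0 + integral {0..b} f'" "f a = f 0 + integral {0..a} f'"
    using admissibleD(4)[OF adm, of b] admissibleD(4)[OF adm, of a] assms 0
    by (metis set_borel_integral_eq_integral(2) order_trans)+
  moreover have "integral {0..a} f' + integral {a..b} f' = integral {0..b} f'"
    using assms 0 by (intro Henstock_Kurzweil_Integration.integral_combine set_borel_integral_eq_integral) auto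
  ultimately show ?thesis using 1 by (metis set_borel_integral_eq_integral(2) add_diff_cancel_left add_diff_cancel_left')
qed

lemma admissible_continuous:
  assumes adm: "admissible c T f f'"
  shows "continuous_on {0..} f"
proof (rule continuous_on_atLeast_0I)
  fix R :: real assume "0 < R"
  then have i: "f' integrable_on {0..R}"
    using admissibleD(3)[OF adm, of R] by (auto intro: set_borel_integral_eq_integral)
  have "continuous_on {0..R} (\<lambda>y. f 0 + integral {0..y} f')"
    by (intro continuous_intros indefinite_integral_continuous_1 i)
  moreover have "f 0 + integral {0..y} f' = f y" if "y \<in> {0..R}" for y
    using admissibleD(3,4)[OF adm, of y] that by (metis set_borel_integral_eq_integral(2) atLeastAtMost_iff)
  ultimately show "continuous_on {0..R} f" by (rule continuous_on_eq)
qed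

lemma set_integrable_exp_decay:
  fixes c :: real
  assumes "0 < c" shows "set_integrable lborel {0..} (\<lambda>y. exp (- c * y))"
proof -
  have "(\<lambda>x. exp (- c * x)) integrable_on {0..}"
    using integrable_on_exp_minus_to_infinity[OF assms, of 0] by simp
  then have "(\<lambda>x. exp (- c * x)) absolutely_integrable_on {0..}"
    by (intro nonnegative_absolutely_integrable_1) auto
  then show ?thesis
    by (auto simp: set_integrable_def integrable_completion)
qed

lemma set_borel_measurable_continuous_atLeast:
  fixes f :: "real \<Rightarrow> real"
  assumes "continuous_on {0..} f" shows "set_borel_measurable lborel {0..} f"
  using borel_measurable_continuous_on_indicator[OF _ assms]
  by (simp add: set_borel_measurable_def)

lemma set_integrable_mult_bounded:
  fixes p v :: "real \<Rightarrow> real"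
  assumes p: "set_integrable lborel A p" and A [measurable]: "A \<in> sets borel"
    and v: "set_borel_measurable lborel A v" "\<And>x. x \<in> A \<Longrightarrow> \<bar>v x\<bar> \<le> M"
  shows "set_integrable lborel A (\<lambda>x. v x * p x)"
  unfolding set_integrable_def
proof (rule Bochner_Integration.integrable_bound)
  show "integrable lborel (\<lambda>x. M *\<^sub>R (indicator A x *\<^sub>R p x))"
    using p by (auto simp: set_integrable_def)
  have "(\<lambda>x. (indicator A x *\<^sub>R v x) * (indicator A x *\<^sub>R p x)) \<in> borel_measurable lborel"
    using v(1) p by (intro borel_measurable_times) (auto simp: set_borel_measurable_def set_integrable_def)
  also have "(\<lambda>x. (indicator A x *\<^sub>R v x) * (indicator A x *\<^sub>R p x)) = (\<lambda>x. indicator A x *\<^sub>R (v x * p x))"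
    by (auto simp: indicator_def)
  finally show "(\<lambda>x. indicator A x *\<^sub>R (v x * p x)) \<in> borel_measurable lborel" .
  show "AE x in lborel. norm (indicator A x *\<^sub>R (v x * p x)) \<le> norm (M *\<^sub>R (indicator A x *\<^sub>R p x))"
  proof (rule AE_I2)
    fix x
    show "norm (indicator A x *\<^sub>R (v x * p x)) \<le> norm (M *\<^sub>R (indicator A x *\<^sub>R p x))"
    proof (cases "x \<in> A")
      case True
      then have "\<bar>v x\<bar> \<le> \<bar>M\<bar>" using v(2)[of x] by simp
      then show ?thesis using True by (simp add: abs_mult mult_right_mono)
    qed simp
  qed
qed

lemma set_integrable_bounded_Icc:
  fixes v :: "real \<Rightarrow> real"
  assumes "set_borel_measurable lborel {a..b} v" "\<And>x. x \<in> {a..b} \<Longrightarrow> \<bar>v x\<bar> \<le> M"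
  shows "set_integrable lborel {a..b} v"
  using set_integrable_mult_bounded[of "{a..b}" "\<lambda>_. 1" v M] assms
  by (simp add: borel_integrable_atLeastAtMost')

text \<open>A non-integrable integrand would have energy 0 by convention, so energies can be
  compared only after this. Admissibility covers the gradient and the fifth power; the linear term
  follows from \<open>f <= 1 + f^2\<close>, the finite mass of the weight and boundedness of
  \<open>g\<close>.\<close>

lemma energy_integrable:
  assumes c: "0 < c" and adm: "admissible c T f f'"
    and g: "set_borel_measurable lborel {0..} g" "\<And>y. 0 \<le> y \<Longrightarrow> \<bar>g y\<bar> \<le> B"
  shows "set_integrable lborel {0..} (\<lambda>y. exp (- c * y) * ((f' y)\<^sup>2 / 2 + (f y) ^ 5 / 5 + g y * f y))"
proof -
  have fnn: "\<And>y. 0 \<le> y \<Longrightarrow> 0 \<le> f y" by (rule admissibleD(2)[OF adm])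
  have 1: "set_integrable lborel {0..} (\<lambda>y. exp (- c * y) * (f' y)\<^sup>2)"
   and 2: "set_integrable lborel {0..} (\<lambda>y. exp (- c * y) * \<bar>f y\<bar> ^ 5)"
   and 3: "set_integrable lborel {0..} (\<lambda>y. exp (- c * y) * (f y)\<^sup>2)"
    by (rule admissibleD[OF adm])+
  have fm: "set_borel_measurable lborel {0..} (\<lambda>y. exp (- c * y) * f y)"
    by (intro set_borel_measurable_continuous_atLeast continuous_intros admissible_continuous[OF adm])
  have "set_integrable lborel {0..} (\<lambda>y. exp (- c * y) * f y)"
  proof (rule set_integrable_bound[OF set_integral_add(1)[OF set_integrable_exp_decay[OF c] 3] fm])
    have "norm (exp (- c * y) * f y) \<le> norm (exp (- c * y) + exp (- c * y) * (f y)\<^sup>2)" if "0 \<le> y" for y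
    proof -
      have "f y \<le> 1 + (f y)\<^sup>2"
        using zero_le_power2[of "f y - 1/2"] by (simp add: power2_eq_square algebra_simps)
      then have "exp (- c * y) * f y \<le> exp (- c * y) * (1 + (f y)\<^sup>2)"
        by (intro mult_left_mono) auto
      moreover have "0 \<le> exp (- c * y) * f y" using fnn[OF that] by simp
      ultimately show ?thesis by (simp add: distrib_left)
    qed
    then show "AE y in lborel. y \<in> {0..} \<longrightarrow> norm (exp (- c * y) * f y) \<le> norm (exp (- c * y) + exp (- c * y) * (f y)\<^sup>2)"
      by auto
  qed
  then have 4: "set_integrable lborel {0..} (\<lambda>y. g y * (exp (- c * y) * f y))"
    by (rule set_integrable_mult_bounded) (use g in auto)
  have "set_integrable lborel {0..} (\<lambda>y. (exp (- c * y) * (f' y)\<^sup>2) / 2 + (exp (- c * y) * \<bar>f y\<bar> ^ 5) / 5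
     + g y * (exp (- c * y) * f y))"
    using 1 2 4 by (intro set_integral_add(1) set_integrable_divide) auto
  also have "?this \<longleftrightarrow> ?thesis"
    by (intro set_integrable_cong) (auto simp: fnn field_simps)
  finally show ?thesis .
qed

text \<open>Reduces the energy difference of two competitors that agree outside
  \<open>{a..b}\<close> to an integral over that bounded interval.\<close>

lemma set_integrable_perturb:
  fixes p q :: "real \<Rightarrow> real"
  assumes p: "set_integrable lborel {0..} p" and r: "set_integrable lborel {a..b} (\<lambda>y. q y - p y)"
    and eq: "\<And>y. 0 \<le> y \<Longrightarrow> y \<notin> {a..b} \<Longrightarrow> q y = p y" and "0 \<le> a"
  shows "set_integrable lborel {0..} q"
    and "(LINT y:{0..}|lborel. q y) = (LINT y:{0..}|lborel. p y) + (LINT y:{a..b}|lborel. q y - p y)"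
proof -
  have e: "indicat_real {0..} y *\<^sub>R q y = indicat_real {0..} y *\<^sub>R p y + indicat_real {a..b} y *\<^sub>R (q y - p y)" for y
    using eq[of y] \<open>0 \<le> a\<close> by (auto simp: indicator_def)
  show "set_integrable lborel {0..} q"
    using p r unfolding set_integrable_def e by (rule Bochner_Integration.integrable_add)
  show "(LINT y:{0..}|lborel. q y) = (LINT y:{0..}|lborel. p y) + (LINT y:{a..b}|lborel. q y - p y)"
    unfolding set_lebesgue_integral_def e
    using p r unfolding set_integrable_def by (rule Bochner_Integration.integral_add)
qed

text \<open>Taylor expansion with a quadratic remainder whose constant depends only on the common
  bound \<open>W\<close>, hence is uniform over an interval.\<close>

lemma fifth_power_expansion:
  fixes x t \<epsilon> W :: real
  assumes "0 \<le> x" "x \<le> W" "\<bar>t\<bar> \<le> W" "0 < \<epsilon>" "\<epsilon> \<le> 1"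
  shows "(x + \<epsilon> * t) ^ 5 / 5 - x ^ 5 / 5 \<le> \<epsilon> * (x ^ 4 * t) + \<epsilon>\<^sup>2 * (6 * W ^ 5)"
proof -
  define s where "s = \<epsilon> * t"
  have W: "0 \<le> W" using assms by simp
  have s: "\<bar>s\<bar> \<le> W" using assms unfolding s_def abs_mult
    by (metis abs_ge_zero abs_of_pos mult_left_le_one_le order_trans less_imp_le)
  have s2: "s\<^sup>2 \<le> \<epsilon>\<^sup>2 * W\<^sup>2"
    using assms abs_le_square_iff[of t W] W by (auto simp: s_def power_mult_distrib intro!: mult_left_mono)
  have a: "x ^ 3 \<le> W ^ 3" using assms by (intro power_mono) auto
  have b: "x\<^sup>2 * s \<le> W\<^sup>2 * W"
    using assms s
    by (intro order_trans[OF mult_left_mono[of s W] mult_right_mono[of "x\<^sup>2" "W\<^sup>2"]]) (auto intro: power_mono)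
  have d: "x * s\<^sup>2 \<le> W * W\<^sup>2" using assms s W abs_le_square_iff[of s W] by (intro mult_mono) auto
  have e: "s ^ 3 \<le> W ^ 3" using s W by (metis abs_ge_self order_trans power_abs power_mono abs_ge_zero)
  \<comment> \<open>The coefficients 10, 10, 5 and 1 sum to 26; rounding up to 30 leaves 6 after
    division by 5.\<close>
  have br: "10 * x ^ 3 + 10 * (x\<^sup>2 * s) + 5 * (x * s\<^sup>2) + s ^ 3 \<le> 30 * W ^ 3"
  proof -
    have lin: "\<And>A B C D w::real. A \<le> w \<Longrightarrow> B \<le> w \<Longrightarrow> C \<le> w \<Longrightarrow> D \<le> w \<Longrightarrow> 0 \<le> w \<Longrightarrow> 10 * A + 10 * B + 5 * C + D \<le> 30 * w"
      by linarith
    have "W\<^sup>2 * W = W ^ 3" "W * W\<^sup>2 = W ^ 3" by (simp_all add: power2_eq_square power3_eq_cube)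
    then show ?thesis using W by (intro lin) (use a b d e in simp_all)
  qed
  have "(x + s) ^ 5 - x ^ 5 = 5 * (x ^ 4 * s) + s\<^sup>2 * (10 * x ^ 3 + 10 * (x\<^sup>2 * s) + 5 * (x * s\<^sup>2) + s ^ 3)"
    by algebra
  also have "\<dots> \<le> 5 * (x ^ 4 * s) + s\<^sup>2 * (30 * W ^ 3)"
    using br by (intro add_left_mono mult_left_mono) auto
  also have "\<dots> \<le> 5 * (x ^ 4 * s) + (\<epsilon>\<^sup>2 * W\<^sup>2) * (30 * W ^ 3)"
    using s2 W by (intro add_left_mono mult_right_mono) auto
  also have "\<dots> = 5 * (\<epsilon> * (x ^ 4 * t) + \<epsilon>\<^sup>2 * (6 * W ^ 5))"
    unfolding s_def by algebra
  finally show ?thesis by (simp add: s_def)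
qed


text \<open>The energy increment along \<open>f + \<epsilon> * p\<close> is at most \<epsilon> times
  the linear term plus a multiple of the square of \<epsilon>; divide by \<epsilon> and let it tend
  to 0. Only positive \<epsilon> have to be feasible, as only one sign is claimed. Since
  \<open>p'\<close> is just a bounded measurable density of \<open>p\<close>, tests with kinks are
  allowed.\<close>

lemma first_variation:
  assumes c: "0 < c" and adm: "admissible c T f f'"
    and min: "\<And>h h'. admissible c T h h' \<Longrightarrow> energy c g f f' \<le> energy c g h h'"
    and g: "set_borel_measurable lborel {0..} g" "\<And>y. 0 \<le> y \<Longrightarrow> \<bar>g y\<bar> \<le> B"
    and ab: "0 \<le> a" "a \<le> b"
    and p'[measurable]: "p' \<in> borel_measurable borel" and p'M: "\<And>y. \<bar>p' y\<bar> \<le> M"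
    and p'0: "\<And>y. 0 \<le> y \<Longrightarrow> y \<notin> {a..b} \<Longrightarrow> p' y = 0"
    and p: "\<And>y. 0 \<le> y \<Longrightarrow> p y = (LINT t:{0..y}|lborel. p' t)"
    and pM: "\<And>y. \<bar>p y\<bar> \<le> M" and p0: "\<And>y. 0 \<le> y \<Longrightarrow> y \<notin> {a..b} \<Longrightarrow> p y = 0"
    and pcont: "continuous_on UNIV p" and pz: "p 0 = 0"
    and e0: "0 < \<epsilon>0" "\<And>\<epsilon> y. 0 < \<epsilon> \<Longrightarrow> \<epsilon> < \<epsilon>0 \<Longrightarrow> a \<le> y \<Longrightarrow> y \<le> b \<Longrightarrow> 0 \<le> f y + \<epsilon> * p y"
  shows "set_integrable lborel {a..b} (\<lambda>y. exp (- c * y) * (f' y * p' y + (f y ^ 4 + g y) * p y))" (is ?int)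
    and "0 \<le> (LINT y:{a..b}|lborel. exp (- c * y) * (f' y * p' y + (f y ^ 4 + g y) * p y))" (is ?le)
proof -
  have fnn: "\<And>y. 0 \<le> y \<Longrightarrow> 0 \<le> f y" by (rule admissibleD(2)[OF adm])
  have fc: "continuous_on {a..b} f"
    by (rule continuous_on_subset[OF admissible_continuous[OF adm]]) (use ab in auto)
  have pc: "continuous_on {a..b} p" by (rule continuous_on_subset[OF pcont]) auto
  have [measurable]: "p \<in> borel_measurable borel" using pcont by (rule borel_measurable_continuous_onI)
  have M0: "0 \<le> M" using p'M[of 0] by simp
  obtain F where F: "\<And>y. y \<in> {a..b} \<Longrightarrow> f y \<le> F"
    using continuous_attains_sup[OF compact_Icc _ fc] ab by (metis atLeastatMost_empty_iff2 linorder_not_le)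
  define W where "W = max M F"
  have W: "f y \<le> W" "\<bar>p y\<bar> \<le> W" if "y \<in> {a..b}" for y
    using F[OF that] pM[of y] by (auto simp: W_def)
  have bm: "set_borel_measurable lborel A v" if "v \<in> borel_measurable borel" "A \<in> sets borel" for A and v :: "real \<Rightarrow> real"
    using that by (simp add: set_borel_measurable_def)
  have ci: "set_integrable lborel {a..b} v" if "continuous_on {a..b} v" for v :: "real \<Rightarrow> real"
    using that by (rule borel_integrable_atLeastAtMost')
  have f'i: "set_integrable lborel {a..b} f'"
    by (rule set_integrable_subset[OF admissibleD(3)[OF adm, of b]]) (use ab in auto)
  have gi: "set_integrable lborel {a..b} g"
  proof (rule set_integrable_bounded_Icc[where M=B])
    show "set_borel_measurable lborel {a..b} g"
      by (rule set_borel_measurable_subset[OF g(1)]) (use ab in auto)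
  qed (use g(2) ab in auto)
  have e1: "exp (- c * y) \<le> 1" if "y \<in> {a..b}" for y using that ab c by auto
  have v1: "set_integrable lborel {a..b} (\<lambda>y. (exp (- c * y) * p' y) * f' y)"
    using e1 p'M by (intro set_integrable_mult_bounded[OF f'i, where M=M] bm)
      (auto simp: abs_mult intro: order_trans[OF mult_left_le_one_le])
  have v2: "set_integrable lborel {a..b} (\<lambda>y. (exp (- c * y) * p y) * g y)"
    using e1 pM by (intro set_integrable_mult_bounded[OF gi, where M=M] bm)
      (auto simp: abs_mult intro: order_trans[OF mult_left_le_one_le])
  have v3: "set_integrable lborel {a..b} (\<lambda>y. exp (- c * y) * (p' y)\<^sup>2)"
  proof (rule set_integrable_bounded_Icc[where M="M\<^sup>2"])
    fix y assume "y \<in> {a..b}"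
    have "(p' y)\<^sup>2 \<le> M\<^sup>2" using p'M[of y] M0 abs_le_square_iff[of "p' y" M] by simp
    then show "\<bar>exp (- c * y) * (p' y)\<^sup>2\<bar> \<le> M\<^sup>2"
      using e1[OF \<open>y \<in> _\<close>] by (auto simp: abs_mult intro: order_trans[OF mult_left_le_one_le])
  qed (intro bm, measurable)
  have v4: "set_integrable lborel {a..b} (\<lambda>y. exp (- c * y) * (f y ^ 4 * p y))"
    by (intro ci continuous_intros fc pc)
  show ?int
  proof -
    have "set_integrable lborel {a..b} (\<lambda>y. (exp (- c * y) * p' y) * f' y + exp (- c * y) * (f y ^ 4 * p y) + (exp (- c * y) * p y) * g y)"
      by (intro set_integral_add(1) v1 v2 v4)
    also have "?this \<longleftrightarrow> ?int" by (intro set_integrable_cong) (auto simp: algebra_simps)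
    finally show ?int .
  qed
  define L where "L = (LINT y:{a..b}|lborel. exp (- c * y) * (f' y * p' y + (f y ^ 4 + g y) * p y))"
  \<comment> \<open>Bound for the second-order part: \<open>M\<^sup>2 / 2\<close> from the squared
    gradient, \<open>6 * W ^ 5\<close> from the fifth power.\<close>
  define Q where "Q = M\<^sup>2 / 2 + 6 * W ^ 5"
  have "0 \<le> W" using M0 by (simp add: W_def)
  then have "0 \<le> Q" by (simp add: Q_def)
  have ki: "set_integrable lborel {a..b} (\<lambda>y. k)" for k :: real by (intro ci continuous_intros)
  have main: "0 \<le> L + \<epsilon> * (Q * (b - a))" if eps: "0 < \<epsilon>" "\<epsilon> < \<epsilon>0" "\<epsilon> \<le> 1" for \<epsilon>
  proof -
    have Q0: "0 \<le> \<epsilon>\<^sup>2 * Q" using \<open>0 \<le> Q\<close> by simp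
    define h where "h = (\<lambda>y. f y + \<epsilon> * p y)"
    define h' where "h' = (\<lambda>y. f' y + \<epsilon> * p' y)"
    have sq: "set_integrable lborel {0..} (\<lambda>y. exp (- c * y) * (h' y)\<^sup>2)"
    proof (rule set_integrable_perturb(1)[OF admissibleD(6)[OF adm] _ _ ab(1)])
      have "set_integrable lborel {a..b} (\<lambda>y. 2 * \<epsilon> * ((exp (- c * y) * p' y) * f' y) + \<epsilon>\<^sup>2 * (exp (- c * y) * (p' y)\<^sup>2))"
        by (intro set_integral_add(1) set_integrable_mult_right v1 v3)
      also have "?this \<longleftrightarrow> set_integrable lborel {a..b} (\<lambda>y. exp (- c * y) * (h' y)\<^sup>2 - exp (- c * y) * (f' y)\<^sup>2)"
        by (intro set_integrable_cong) (auto simp: h'_def power2_eq_square algebra_simps)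
      finally show "set_integrable lborel {a..b} (\<lambda>y. exp (- c * y) * (h' y)\<^sup>2 - exp (- c * y) * (f' y)\<^sup>2)" .
    qed (simp add: h'_def p'0)
    have admh: "admissible c T h h'"
      unfolding admissible_def
    proof (intro conjI allI impI)
      show "h 0 = T" using admissibleD(1)[OF adm] pz by (simp add: h_def)
      show "0 \<le> h y" if "0 \<le> y" for y
        using e0(2)[OF eps(1,2), of y] fnn[OF that] p0[OF that] by (cases "y \<in> {a..b}") (auto simp: h_def)
      have pi: "set_integrable lborel {0..y} p'" for y
        by (rule set_integrable_bounded_Icc[where M=M]) (use p'M bm in auto)
      show "set_integrable lborel {0..y} h'" if "0 \<le> y" for y
        unfolding h'_def by (intro set_integral_add(1) set_integrable_mult_right admissibleD(3)[OF adm] pi that)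
      show "h y = h 0 + (LINT t:{0..y}|lborel. h' t)" if y: "0 \<le> y" for y
      proof -
        have "(LINT t:{0..y}|lborel. h' t) = (LINT t:{0..y}|lborel. f' t) + \<epsilon> * (LINT t:{0..y}|lborel. p' t)"
          unfolding h'_def by (subst set_integral_add(2)) (use admissibleD(3)[OF adm y] pi in auto)
        then show ?thesis
          using admissibleD(4)[OF adm y] p[OF y] pz by (simp add: h_def)
      qed
      show "set_integrable lborel {0..} (\<lambda>y. exp (- c * y) * (h y)\<^sup>2)"
        by (rule set_integrable_perturb(1)[OF admissibleD(5)[OF adm] _ _ ab(1)])
           (auto simp: h_def p0 intro!: ci continuous_intros fc pc)
      show "set_integrable lborel {0..} (\<lambda>y. exp (- c * y) * \<bar>h y\<bar> ^ 5)"
        by (rule set_integrable_perturb(1)[OF admissibleD(7)[OF adm] _ _ ab(1)])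
           (auto simp: h_def p0 intro!: ci continuous_intros fc pc)
    qed (fact sq)
    let ?P = "\<lambda>y. exp (- c * y) * ((f' y)\<^sup>2 / 2 + (f y) ^ 5 / 5 + g y * f y)"
    let ?R = "\<lambda>y. exp (- c * y) * ((h' y)\<^sup>2 / 2 + (h y) ^ 5 / 5 + g y * h y)"
    have Ri: "set_integrable lborel {a..b} ?R" "set_integrable lborel {a..b} ?P"
      by (rule set_integrable_subset[OF energy_integrable[OF c admh g]]; use ab in auto)
         (rule set_integrable_subset[OF energy_integrable[OF c adm g]]; use ab in auto)
    then have di: "set_integrable lborel {a..b} (\<lambda>y. ?R y - ?P y)" by (rule set_integral_diff(1))
    have "energy c g h h' = energy c g f f' + (LINT y:{a..b}|lborel. ?R y - ?P y)"
      unfolding energy_def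
      by (rule set_integrable_perturb(2)[OF energy_integrable[OF c adm g] di _ ab(1)])
         (simp_all add: h_def h'_def p0 p'0 g(2))
    with min[OF admh] have "0 \<le> (LINT y:{a..b}|lborel. ?R y - ?P y)" by simp
    also have "\<dots> \<le> (LINT y:{a..b}|lborel. \<epsilon> * (exp (- c * y) * (f' y * p' y + (f y ^ 4 + g y) * p y)) + \<epsilon>\<^sup>2 * Q)"
    proof (rule set_integral_mono[OF di])
      show "set_integrable lborel {a..b} (\<lambda>y. \<epsilon> * (exp (- c * y) * (f' y * p' y + (f y ^ 4 + g y) * p y)) + \<epsilon>\<^sup>2 * Q)"
        by (intro set_integral_add(1)[OF set_integrable_mult_right[OF \<open>?int\<close>] ki])
      fix y assume y: "y \<in> {a..b}"
      have q: "(p' y)\<^sup>2 \<le> M\<^sup>2" using p'M[of y] M0 abs_le_square_iff[of "p' y" M] by simp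
      have lin: "(A + F + G) - (A' + F' + G') \<le> (x + z + v) + (m' + w)"
        if "F - F' \<le> z + w" "A - A' = x + m" "m \<le> m'" "G - G' = v" for A A' F F' G G' x z v m m' w :: real
        using that by linarith
      have "(h y) ^ 5 / 5 - (f y) ^ 5 / 5 \<le> \<epsilon> * (f y ^ 4 * p y) + \<epsilon>\<^sup>2 * (6 * W ^ 5)"
        unfolding h_def using y ab by (intro fifth_power_expansion W fnn eps) auto
      moreover have "(h' y)\<^sup>2 / 2 - (f' y)\<^sup>2 / 2 = \<epsilon> * (f' y * p' y) + \<epsilon>\<^sup>2 * ((p' y)\<^sup>2 / 2)"
        unfolding h'_def by (simp add: power2_eq_square algebra_simps)
      moreover have "\<epsilon>\<^sup>2 * ((p' y)\<^sup>2 / 2) \<le> \<epsilon>\<^sup>2 * (M\<^sup>2 / 2)"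
        using q by (intro mult_left_mono) auto
      moreover have "g y * h y - g y * f y = \<epsilon> * (g y * p y)" by (simp add: h_def algebra_simps)
      ultimately have "((h' y)\<^sup>2 / 2 + (h y) ^ 5 / 5 + g y * h y) - ((f' y)\<^sup>2 / 2 + (f y) ^ 5 / 5 + g y * f y)
          \<le> (\<epsilon> * (f' y * p' y) + \<epsilon> * (f y ^ 4 * p y) + \<epsilon> * (g y * p y)) + (\<epsilon>\<^sup>2 * (M\<^sup>2 / 2) + \<epsilon>\<^sup>2 * (6 * W ^ 5))"
        by (rule lin)
      also have "\<dots> = \<epsilon> * (f' y * p' y + (f y ^ 4 + g y) * p y) + \<epsilon>\<^sup>2 * Q"
        by (simp only: Q_def distrib_left distrib_right add.assoc)
      finally have "((h' y)\<^sup>2 / 2 + (h y) ^ 5 / 5 + g y * h y) - ((f' y)\<^sup>2 / 2 + (f y) ^ 5 / 5 + g y * f y)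
          \<le> \<epsilon> * (f' y * p' y + (f y ^ 4 + g y) * p y) + \<epsilon>\<^sup>2 * Q" .
      from mult_left_mono[OF this exp_ge_zero, of "- c * y"]
      have "?R y - ?P y \<le> exp (- c * y) * (\<epsilon> * (f' y * p' y + (f y ^ 4 + g y) * p y)) + exp (- c * y) * (\<epsilon>\<^sup>2 * Q)"
        by (simp only: right_diff_distrib distrib_left)
      also have "exp (- c * y) * (\<epsilon>\<^sup>2 * Q) \<le> \<epsilon>\<^sup>2 * Q"
        using mult_right_mono[OF e1[OF y] Q0] by simp
      finally show "?R y - ?P y \<le> \<epsilon> * (exp (- c * y) * (f' y * p' y + (f y ^ 4 + g y) * p y)) + \<epsilon>\<^sup>2 * Q"
        by (simp only: mult.left_commute)
    qed
    also have "\<dots> = (LINT y:{a..b}|lborel. \<epsilon> * (exp (- c * y) * (f' y * p' y + (f y ^ 4 + g y) * p y))) + (LINT y:{a..b}|lborel. \<epsilon>\<^sup>2 * Q)"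
      by (rule set_integral_add(2)[OF set_integrable_mult_right[OF \<open>?int\<close>] ki])
    also have "\<dots> = \<epsilon> * L + \<epsilon>\<^sup>2 * Q * (b - a)"
      using ab by (simp add: L_def set_lebesgue_integral_def)
    finally have "0 \<le> \<epsilon> * (L + \<epsilon> * (Q * (b - a)))" by (simp only: power2_eq_square distrib_left mult.assoc)
    then show ?thesis using eps(1) by (simp add: zero_le_mult_iff)
  qed
  have "((\<lambda>\<epsilon>. L + \<epsilon> * (Q * (b - a))) \<longlongrightarrow> L + 0 * (Q * (b - a))) (at_right 0)"
    by (intro tendsto_intros)
  moreover have "eventually (\<lambda>\<epsilon>. 0 \<le> L + \<epsilon> * (Q * (b - a))) (at_right 0)"
    unfolding eventually_at_right_field using main e0(1) by (intro exI[of _ "min \<epsilon>0 1"]) auto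
  ultimately have "0 \<le> L + 0 * (Q * (b - a))"
    by (intro tendsto_lowerbound) auto
  then show ?le by (simp add: L_def)
qed


section \<open>Green functions as test functions\<close>

text \<open>Up to the factor \<open>c\<close>, \<open>green c a b s\<close> is the Green function with pole \<open>s\<close> of
  \<open>- (e\<^bsup>-cy\<^esup> \<phi>')'\<close> on \<open>[a, b]\<close> with zero boundary values.\<close>

definition ramp :: "real \<Rightarrow> real \<Rightarrow> real \<Rightarrow> real \<Rightarrow> real" where
  "ramp c a s y = exp (c * max a (min y s)) - exp (c * a)"

text \<open>Constants and \<open>exp (c * y)\<close> span the solutions of
  \<open>f'' - c f' = 0\<close>; this is the value at \<open>s\<close> of the solution that is 0 at
  \<open>a\<close> and 1 at \<open>b\<close>.\<close>

definition kap :: "real \<Rightarrow> real \<Rightarrow> real \<Rightarrow> real \<Rightarrow> real" where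
  "kap c a b s = (exp (c * s) - exp (c * a)) / (exp (c * b) - exp (c * a))"

definition green :: "real \<Rightarrow> real \<Rightarrow> real \<Rightarrow> real \<Rightarrow> real \<Rightarrow> real" where
  "green c a b s y = ramp c a s y - kap c a b s * ramp c a b y"

lemma integral_ramp_deriv:
  assumes "0 \<le> a" "a \<le> s" "0 \<le> y"
  shows "(LINT t:{0..y}|lborel. indicator {a..s} t * (c * exp (c * t))) = ramp c a s y"
proof (cases "y < a")
  case True
  then have "(LINT t:{0..y}|lborel. indicator {a..s} t * (c * exp (c * t))) = (LINT t:{0..y}|lborel. 0)"
    by (intro set_lebesgue_integral_cong) auto
  then show ?thesis using True by (simp add: ramp_def)
next
  case False
  have "(LINT t:{0..y}|lborel. indicator {a..s} t * (c * exp (c * t)))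
      = (LINT t|lborel. (c * exp (c * t)) * indicator {a..min y s} t)"
    unfolding set_lebesgue_integral_def using assms
    by (intro Bochner_Integration.integral_cong) (auto simp: indicator_def)
  also have "\<dots> = exp (c * min y s) - exp (c * a)"
    using assms False
    by (intro integral_FTC_Icc_real) (auto intro!: derivative_eq_intros continuous_intros)
  finally show ?thesis using False assms by (simp add: ramp_def max_def)
qed

context
  fixes c a b s :: real
  assumes c: "0 < c" and ab: "a < b" and s: "a \<le> s" "s \<le> b"
begin

lemma kap_bounds: "0 \<le> kap c a b s" "kap c a b s \<le> 1"
  using c ab s by (auto simp: kap_def divide_le_eq)

lemma ramp_nonneg: "0 \<le> ramp c a t y"
  using c by (simp add: ramp_def)

text \<open>Left of the pole both ramps coincide and \<open>kap\<close> is at most 1. Right of it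
  the first ramp has reached its maximum, and \<open>kap\<close> is normalized so that the scaled
  second ramp attains that value only at \<open>b\<close>.\<close>

lemma green_nonneg: "0 \<le> green c a b s y"
proof (cases "y \<le> s")
  case True
  then have "ramp c a b y = ramp c a s y" using s by (simp add: ramp_def)
  then show ?thesis using kap_bounds ramp_nonneg[of s y] by (simp add: green_def mult_left_le_one_le)
next
  case False
  have "kap c a b s * ramp c a b y \<le> kap c a b s * (exp (c * b) - exp (c * a))"
    using kap_bounds c ab by (intro mult_left_mono) (auto simp: ramp_def)
  also have "\<dots> = exp (c * s) - exp (c * a)"
    using c ab by (simp add: kap_def)
  also have "\<dots> = ramp c a s y" using False s by (simp add: ramp_def)
  finally show ?thesis by (simp add: green_def)
qed

lemma green_le_ramp: "green c a b s y \<le> ramp c a s y"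
  using kap_bounds ramp_nonneg[of b y] by (simp add: green_def)

lemma green_le: "green c a b s y \<le> exp (c * b)"
proof -
  have "ramp c a s y \<le> exp (c * max a (min y s))" by (simp add: ramp_def)
  also have "\<dots> \<le> exp (c * b)" using c ab s by simp
  finally show ?thesis using green_le_ramp[of y] by simp
qed

lemma green_outside: "y \<notin> {a..b} \<Longrightarrow> green c a b s y = 0"
  using c ab s by (auto simp: green_def ramp_def kap_def)

lemma green_continuous: "continuous_on A (green c a b s)"
  unfolding green_def[abs_def] ramp_def[abs_def] by (intro continuous_intros)

text \<open>The bound is linear in the length of the interval, so integrating over the interval
  gives a quadratically small reaction term.\<close>

lemma green_weight_le:
  assumes "y \<in> {a..b}" shows "exp (- c * y) * green c a b s y \<le> c * (b - a)"
proof -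
  have "max a (min y s) \<le> y" using assms s by auto
  then have "green c a b s y \<le> exp (c * y) - exp (c * a)"
    using green_le_ramp[of y] c by (intro order_trans[OF green_le_ramp]) (simp add: ramp_def)
  then have "exp (- c * y) * green c a b s y \<le> exp (- c * y) * (exp (c * y) - exp (c * a))"
    by (intro mult_left_mono) auto
  also have "\<dots> = 1 - exp (- c * (y - a))"
    by (simp add: right_diff_distrib exp_add[symmetric] algebra_simps)
  also have "\<dots> \<le> c * (y - a)" using exp_ge_add_one_self[of "- c * (y - a)"] by simp
  also have "\<dots> \<le> c * (b - a)" using c assms by simp
  finally show ?thesis .
qed

text \<open>The weight \<open>exp (- c * y)\<close> cancels the exponential in the derivative of a
  ramp. The gradient term therefore integrates to values of \<open>f\<close> at the pole and the two
  ends, and no second derivative of \<open>f\<close> appears. The factor \<sigma> will be 1, and -1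
  where \<open>f\<close> is positive.\<close>

lemma green_variation:
  assumes adm: "admissible c T f f'"
    and min: "\<And>h h'. admissible c T h h' \<Longrightarrow> energy c g f f' \<le> energy c g h h'"
    and g: "set_borel_measurable lborel {0..} g" "\<And>y. 0 \<le> y \<Longrightarrow> \<bar>g y\<bar> \<le> B"
    and a: "0 \<le> a"
    and e0: "0 < \<epsilon>0" "\<And>\<epsilon> y. 0 < \<epsilon> \<Longrightarrow> \<epsilon> < \<epsilon>0 \<Longrightarrow> a \<le> y \<Longrightarrow> y \<le> b \<Longrightarrow> 0 \<le> f y + \<epsilon> * (\<sigma> * green c a b s y)"
  shows "0 \<le> \<sigma> * (c * (f s - f a - kap c a b s * (f b - f a)) +
           (LINT y:{a..b}|lborel. exp (- c * y) * ((f y ^ 4 + g y) * green c a b s y)))"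
proof -
  define \<kappa> where "\<kappa> = kap c a b s"
  define p where "p = (\<lambda>y. \<sigma> * green c a b s y)"
  \<comment> \<open>A weak derivative of \<open>p\<close>; on \<open>{a..b}\<close> the weight turns
    it into a multiple of the step function \<open>indicator {a..s} y - \<kappa>\<close>.\<close>
  define q where "q = (\<lambda>y. \<sigma> * (indicator {a..s} y * (c * exp (c * y)) - \<kappa> * (indicator {a..b} y * (c * exp (c * y)))))"
  define M where "M = \<bar>\<sigma>\<bar> * ((1 + c) * exp (c * b))"
  have \<kappa>: "0 \<le> \<kappa>" "\<kappa> \<le> 1" unfolding \<kappa>_def by (fact kap_bounds)+
  have meas: "q \<in> borel_measurable borel" unfolding q_def by measurable
  have qM: "\<bar>q y\<bar> \<le> M" for y
  proof (cases "y \<in> {a..b}")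
    case True
    then have "q y = \<sigma> * (c * exp (c * y)) * (indicator {a..s} y - \<kappa>)"
      by (simp add: q_def algebra_simps)
    moreover have "\<bar>indicator {a..s} y - \<kappa>\<bar> \<le> (1::real)" using \<kappa> by (auto simp: indicator_def)
    then have "\<bar>\<sigma>\<bar> * (c * exp (c * y)) * \<bar>indicator {a..s} y - \<kappa>\<bar> \<le> \<bar>\<sigma>\<bar> * (c * exp (c * y)) * 1"
      using c by (intro mult_left_mono) auto
    ultimately have "\<bar>q y\<bar> \<le> \<bar>\<sigma>\<bar> * (c * exp (c * y)) * 1"
      using c by (simp add: abs_mult)
    also have "\<dots> \<le> M" unfolding M_def mult_1_right
      using c True by (intro mult_left_mono mult_mono) auto
    finally show ?thesis .
  next
    case False
    then have "q y = 0" using s by (auto simp: q_def)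
    then show ?thesis using c by (simp add: M_def)
  qed
  have pM: "\<bar>p y\<bar> \<le> M" for y
  proof -
    have "\<bar>p y\<bar> = \<bar>\<sigma>\<bar> * green c a b s y" using green_nonneg[of y] by (simp add: p_def abs_mult)
    also have "green c a b s y \<le> (1 + c) * exp (c * b)"
      using c by (intro order_trans[OF green_le]) (simp add: distrib_right)
    finally show ?thesis by (simp add: M_def mult_left_mono)
  qed
  have pint: "p y = (LINT t:{0..y}|lborel. q t)" if y: "0 \<le> y" for y
  proof -
    have i: "set_integrable lborel {0..y} (\<lambda>t. indicator {a..r} t * (c * exp (c * t)))" for r
    proof (rule set_integrable_bounded_Icc[where M="c * exp (c * y)"])
      show "\<bar>indicator {a..r} t * (c * exp (c * t))\<bar> \<le> c * exp (c * y)" if "t \<in> {0..y}" for t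
        using that c by (auto simp: indicator_def abs_mult)
    qed (simp add: set_borel_measurable_def)
    have "(LINT t:{0..y}|lborel. q t) = \<sigma> * (ramp c a s y - \<kappa> * ramp c a b y)"
      unfolding q_def set_integral_mult_right using i y a s ab
      by (subst set_integral_diff(2)) (auto simp: integral_ramp_deriv)
    then show ?thesis by (simp add: p_def green_def \<kappa>_def)
  qed
  have p0: "p y = 0" if "y \<notin> {a..b}" for y using green_outside[OF that] by (simp add: p_def)
  have pz: "p 0 = 0" using a s ab by (simp add: p_def green_def ramp_def)
  note fv = first_variation[OF c adm min g a less_imp_le[OF ab] meas qM _ pint pM p0 _ pz e0(1)]
  have pcont: "continuous_on UNIV p" unfolding p_def by (intro continuous_intros green_continuous)
  have q0: "q y = 0" if "y \<notin> {a..b}" for y using that s by (auto simp: q_def)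
  let ?I = "\<lambda>y. exp (- c * y) * (f' y * q y + (f y ^ 4 + g y) * p y)"
  have I: "set_integrable lborel {a..b} ?I" "0 \<le> (LINT y:{a..b}|lborel. ?I y)"
    by (rule fv; use q0 pcont e0(2) in \<open>auto simp: p_def\<close>)+
  have f'i: "set_integrable lborel {a..b} f'"
    by (rule set_integrable_subset[OF admissibleD(3)[OF adm, of b]]) (use ab a in auto)
  have f'is: "set_integrable lborel {a..b} (\<lambda>y. indicator {a..s} y * f' y)"
    by (rule set_integrable_mult_bounded[OF f'i, where M=1]) (auto simp: set_borel_measurable_def indicator_def)
  let ?J = "\<lambda>y. \<sigma> * (c * (indicator {a..s} y * f' y - \<kappa> * f' y))"
  have J: "set_integrable lborel {a..b} ?J"
    by (intro set_integrable_mult_right set_integral_diff(1) f'i f'is)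
  have "(LINT y:{a..b}|lborel. ?J y) = \<sigma> * (c * ((LINT y:{a..b}|lborel. indicator {a..s} y * f' y) - \<kappa> * (LINT y:{a..b}|lborel. f' y)))"
    unfolding set_integral_mult_right
    by (subst set_integral_diff(2)) (use f'i f'is in auto)
  also have "(LINT y:{a..b}|lborel. indicator {a..s} y * f' y) = (LINT y:{a..s}|lborel. f' y)"
    unfolding set_lebesgue_integral_def using s
    by (intro Bochner_Integration.integral_cong) (auto simp: indicator_def)
  finally have Jv: "(LINT y:{a..b}|lborel. ?J y) = \<sigma> * (c * ((f s - f a) - \<kappa> * (f b - f a)))"
    using admissible_diff[OF adm a] s ab by simp
  have eq: "?I y - ?J y = \<sigma> * (exp (- c * y) * ((f y ^ 4 + g y) * green c a b s y))" if "y \<in> {a..b}" for y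
  proof -
    have "exp (- c * y) * (f' y * q y) = (exp (- c * y) * exp (c * y)) * ?J y"
      using that by (simp add: q_def algebra_simps)
    also have "exp (- c * y) * exp (c * y) = 1" by (simp add: exp_add[symmetric])
    finally have "exp (- c * y) * (f' y * q y) = ?J y" by simp
    then show ?thesis by (simp add: distrib_left p_def mult.left_commute)
  qed
  have "(LINT y:{a..b}|lborel. \<sigma> * (exp (- c * y) * ((f y ^ 4 + g y) * green c a b s y))) = (LINT y:{a..b}|lborel. ?I y - ?J y)"
    by (rule set_lebesgue_integral_cong) (auto simp only: eq sets_lborel borel_closed closed_atLeastAtMost)
  also have "\<dots> = (LINT y:{a..b}|lborel. ?I y) - (LINT y:{a..b}|lborel. ?J y)"
    by (rule set_integral_diff(2)[OF I(1) J])
  finally have "\<sigma> * (LINT y:{a..b}|lborel. exp (- c * y) * ((f y ^ 4 + g y) * green c a b s y))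
      = (LINT y:{a..b}|lborel. ?I y) - (LINT y:{a..b}|lborel. ?J y)"
    by (simp only: set_integral_mult_right)
  then show ?thesis using I(2) Jv unfolding distrib_left \<kappa>_def by linarith
qed

end


section \<open>Bounds for minimizers\<close>

text \<open>Otherwise the integral over \<open>{b0..b0 + n}\<close> would be at least
  \<open>n\<close> for every \<open>n\<close>. Thus along arbitrarily large points \<open>f\<close>
  is at most \<open>exp (c * b / 2)\<close>, which is of lower order than
  \<open>exp (c * b)\<close>.\<close>

lemma frequently_below_exp:
  fixes f :: "real \<Rightarrow> real"
  assumes i: "set_integrable lborel {0..} (\<lambda>y. exp (- c * y) * (f y)\<^sup>2)" and "0 \<le> b0"
  shows "\<exists>b\<ge>b0. exp (- c * b) * (f b)\<^sup>2 \<le> 1"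
proof (rule ccontr)
  assume "\<not> ?thesis"
  then have gt: "\<And>b. b0 \<le> b \<Longrightarrow> 1 < exp (- c * b) * (f b)\<^sup>2" by force
  define I where "I = (LINT y:{0..}|lborel. exp (- c * y) * (f y)\<^sup>2)"
  have "real n \<le> I" for n
  proof -
    have "real n = (LINT y|lborel. indicat_real {b0..b0 + real n} y)" by simp
    also have "\<dots> \<le> (LINT y|lborel. indicat_real {0..} y *\<^sub>R (exp (- c * y) * (f y)\<^sup>2))"
    proof (rule integral_mono)
      show "integrable lborel (indicat_real {b0..b0 + real n})"
        by (rule integrable_real_indicator) (auto simp: emeasure_lborel_Icc_eq)
      show "integrable lborel (\<lambda>y. indicat_real {0..} y *\<^sub>R (exp (- c * y) * (f y)\<^sup>2))"
        using i by (simp add: set_integrable_def)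
      fix y
      show "indicat_real {b0..b0 + real n} y \<le> indicat_real {0..} y *\<^sub>R (exp (- c * y) * (f y)\<^sup>2)"
        using gt[of y] \<open>0 \<le> b0\<close> by (auto simp: indicator_def)
    qed
    finally show ?thesis by (simp add: I_def set_lebesgue_integral_def)
  qed
  then show False using reals_Archimedean2[of I] by (metis not_le)
qed

text \<open>Shows that at the centre of a short interval both endpoint weights stay away from zero,
  however small the radius.\<close>

lemma kap_symmetric:
  assumes "0 < c" "0 < r"
  shows "kap c (y - r) (y + r) y = 1 / (exp (c * r) + 1)"
proof -
  define e x where "e = exp (c * y)" and "x = exp (c * r)"
  have x: "1 < x" and e: "0 < e" using assms by (auto simp: x_def e_def)
  have 1: "exp (c * (y - r)) = e / x" "exp (c * (y + r)) = e * x"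
    by (simp_all add: e_def x_def exp_diff exp_add algebra_simps)
  have "kap c (y - r) (y + r) y = (e - e / x) / (e * x - e / x)"
    unfolding kap_def 1 e_def by simp
  also have "\<dots> = (e * (x - 1) / x) / ((e * (x - 1) / x) * (x + 1))"
    using x by (simp add: field_simps)
  also have "\<dots> = 1 / (x + 1)" using x e by simp
  finally show ?thesis by (simp add: x_def)
qed

text \<open>The bounds on \<open>g\<close> are those of a source generated by a profile with values
  between 0 and \<open>T\<close>.\<close>

locale minimizer =
  fixes c T :: real and g f f' :: "real \<Rightarrow> real"
  assumes c: "0 < c" and T: "0 < T" and adm: "admissible c T f f'"
    and min: "\<And>h h'. admissible c T h h' \<Longrightarrow> energy c g f f' \<le> energy c g h h'"
    and gm: "set_borel_measurable lborel {0..} g"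
    and g_le: "\<And>y. 0 \<le> y \<Longrightarrow> g y \<le> 0" and g_ge: "\<And>y. 0 \<le> y \<Longrightarrow> - (T ^ 4) \<le> g y"
begin

lemma g_abs: "0 \<le> y \<Longrightarrow> \<bar>g y\<bar> \<le> T ^ 4"
  using g_le[of y] g_ge[of y] by auto

lemma f_nonneg: "0 \<le> y \<Longrightarrow> 0 \<le> f y" by (rule admissibleD(2)[OF adm])

lemma f_continuous: "0 \<le> a \<Longrightarrow> continuous_on {a..b} f"
  by (rule continuous_on_subset[OF admissible_continuous[OF adm]]) auto

lemma level_compact:
  assumes "0 \<le> l" shows "compact {y\<in>{l..u}. f y = v}"
proof -
  have "closed {y\<in>{l..u}. f y = v}"
    using continuous_closed_preimage_constant[OF f_continuous[OF assms]] by simp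
  then have "compact ({l..u} \<inter> {y\<in>{l..u}. f y = v})" by (intro compact_Int_closed) auto
  also have "{l..u} \<inter> {y\<in>{l..u}. f y = v} = {y\<in>{l..u}. f y = v}" by auto
  finally show ?thesis .
qed

text \<open>A nonnegative test may be added to \<open>f\<close> without violating the constraint,
  whatever the zeros of \<open>f\<close>.\<close>

lemma green_ineq:
  assumes "0 \<le> a" "a < b" "a \<le> s" "s \<le> b"
  shows "0 \<le> c * (f s - f a - kap c a b s * (f b - f a)) +
           (LINT y:{a..b}|lborel. exp (- c * y) * ((f y ^ 4 + g y) * green c a b s y))"
proof -
  have "0 \<le> f y + \<epsilon> * (1 * green c a b s y)" if "0 < \<epsilon>" "a \<le> y" for \<epsilon> y
    using f_nonneg[of y] green_nonneg[OF c assms(2-4), of y] assms(1) that by simp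
  from green_variation[OF c assms(2-4) adm min gm g_abs assms(1) zero_less_one this]
  show ?thesis by simp
qed

text \<open>On a compact interval a positive continuous \<open>f\<close> has a positive minimum, so
  small multiples of the Green function may also be subtracted.\<close>

lemma green_eq:
  assumes "0 \<le> a" "a < b" "a \<le> s" "s \<le> b" and pos: "\<And>y. a \<le> y \<Longrightarrow> y \<le> b \<Longrightarrow> 0 < f y"
  shows "c * (f s - f a - kap c a b s * (f b - f a)) +
           (LINT y:{a..b}|lborel. exp (- c * y) * ((f y ^ 4 + g y) * green c a b s y)) = 0"
proof (rule antisym)
  obtain z where z: "z \<in> {a..b}" "\<And>y. y \<in> {a..b} \<Longrightarrow> f z \<le> f y"
    using continuous_attains_inf[OF compact_Icc _ f_continuous[OF assms(1)], of b] assms(2) by fastforce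
  \<comment> \<open>The minimum of \<open>f\<close> divided by the upper bound for the Green
    function.\<close>
  define \<epsilon>0 where "\<epsilon>0 = f z / exp (c * b)"
  have "0 < \<epsilon>0" using pos[of z] z by (simp add: \<epsilon>0_def)
  have "0 \<le> f y + \<epsilon> * (- 1 * green c a b s y)" if "0 < \<epsilon>" "\<epsilon> < \<epsilon>0" "a \<le> y" "y \<le> b" for \<epsilon> y
  proof -
    have "\<epsilon> * green c a b s y \<le> \<epsilon>0 * exp (c * b)"
      using that green_nonneg[OF c assms(2-4), of y] green_le[OF c assms(2-4), of y] by (intro mult_mono) auto
    also have "\<dots> = f z" by (simp add: \<epsilon>0_def)
    also have "\<dots> \<le> f y" using z(2)[of y] that by simp
    finally show ?thesis by simp
  qed
  from green_variation[OF c assms(2-4) adm min gm g_abs assms(1) \<open>0 < \<epsilon>0\<close> this]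
  show "c * (f s - f a - kap c a b s * (f b - f a)) +
           (LINT y:{a..b}|lborel. exp (- c * y) * ((f y ^ 4 + g y) * green c a b s y)) \<le> 0"
    by (simp only: mult_minus_left mult_1_left neg_0_le_iff_le)
qed (rule green_ineq[OF assms(1-4)])

text \<open>Where \<open>f >= T\<close> the term \<open>f ^ 4 + g\<close> is nonnegative, so
  \<open>f\<close> is a subsolution of \<open>f'' - c f' = 0\<close> and lies below the solution
  with the same end values.\<close>

lemma f_le_interpolation:
  assumes "0 \<le> a" "a < b" "a \<le> s" "s \<le> b" and ge: "\<And>y. a \<le> y \<Longrightarrow> y \<le> b \<Longrightarrow> T \<le> f y"
  shows "f s \<le> f a + kap c a b s * (f b - f a)"
proof -
  have "0 \<le> (LINT y:{a..b}|lborel. exp (- c * y) * ((f y ^ 4 + g y) * green c a b s y))"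
    unfolding set_lebesgue_integral_def
  proof (intro Bochner_Integration.integral_nonneg)
    fix y
    have "0 \<le> f y ^ 4 + g y" if "y \<in> {a..b}"
    proof -
      have "T ^ 4 \<le> f y ^ 4" using ge[of y] T that by (intro power_mono) auto
      moreover have "- (T ^ 4) \<le> g y" using g_ge[of y] that assms(1) by simp
      ultimately show ?thesis by linarith
    qed
    then show "0 \<le> indicat_real {a..b} y *\<^sub>R (exp (- c * y) * ((f y ^ 4 + g y) * green c a b s y))"
      using green_nonneg[OF c assms(2-4), of y] by (auto simp: indicator_def)
  qed
  moreover have "0 < f y" if "a \<le> y" "y \<le> b" for y using ge[OF that] T by simp
  ultimately have "c * (f s - f a - kap c a b s * (f b - f a)) \<le> 0"
    using green_eq[OF assms(1-4)] by simp
  then show ?thesis using c by (simp add: mult_le_0_iff)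
qed

text \<open>Maximum principle on an excursion above \<open>T\<close>. If the excursion ends, both
  end values are \<open>T\<close> and the interpolation is \<open>T\<close>. If it never ends, it is
  cut at a far point \<open>b\<close> with \<open>f b <= exp (c * b / 2)\<close>; there
  \<open>kap\<close> is of order \<open>exp (- c * b)\<close>, too small to lift \<open>f s\<close>
  above \<open>T\<close> by a fixed amount.\<close>

lemma f_le_T:
  assumes "0 \<le> s" shows "f s \<le> T"
proof (rule ccontr)
  assume "\<not> f s \<le> T"
  then have gt: "T < f s" by simp
  have f0: "f 0 = T" by (rule admissibleD(1)[OF adm])
  obtain a where a: "0 \<le> a" "a \<le> s" "f a = T" and amax: "\<And>y. 0 \<le> y \<Longrightarrow> y \<le> s \<Longrightarrow> f y = T \<Longrightarrow> y \<le> a"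
  proof -
    have "{y\<in>{0..s}. f y = T} \<noteq> {}" using f0 assms by auto
    from compact_attains_sup[OF level_compact this] show ?thesis by (auto intro: that)
  qed
  have as: "a < s" using a gt by (cases "a = s") auto
  have left: "T \<le> f y" if y: "a \<le> y" "y \<le> s" for y
  proof (rule ccontr)
    assume "\<not> T \<le> f y"
    then obtain x where x: "y \<le> x" "x \<le> s" "f x = T"
      using IVT'[of f y T s, OF _ _ _ f_continuous] y a gt by auto
    then have "x = a" using amax[of x] y a by auto
    then have "y = a" using x y by auto
    then show False using \<open>\<not> T \<le> f y\<close> a by simp
  qed
  show False
  proof (cases "\<exists>b1>s. f b1 \<le> T")
    case True
    then obtain b1 where b1: "s < b1" "f b1 \<le> T" by auto
    obtain b where b: "s \<le> b" "b \<le> b1" "f b = T" and bmin: "\<And>y. s \<le> y \<Longrightarrow> y \<le> b1 \<Longrightarrow> f y = T \<Longrightarrow> b \<le> y"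
    proof -
      have "\<exists>x. s \<le> x \<and> x \<le> b1 \<and> f x = T"
        using IVT2'[of f b1 T s, OF _ _ _ f_continuous] b1 assms gt by auto
      then have "{y\<in>{s..b1}. f y = T} \<noteq> {}" by auto
      from compact_attains_inf[OF level_compact[OF assms] this] show ?thesis by (auto intro: that)
    qed
    have sb: "s < b" using b gt by (cases "b = s") auto
    have right: "T \<le> f y" if y: "s \<le> y" "y \<le> b" for y
    proof (rule ccontr)
      assume "\<not> T \<le> f y"
      then obtain x where x: "s \<le> x" "x \<le> y" "f x = T"
        using IVT2'[of f y T s, OF _ _ _ f_continuous] y assms gt by auto
      then have "x = b" using bmin[of x] y b by auto
      then have "y = b" using x y by auto
      then show False using \<open>\<not> T \<le> f y\<close> b by simp
    qed
    have "f s \<le> f a + kap c a b s * (f b - f a)"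
    proof (rule f_le_interpolation)
      show "T \<le> f y" if "a \<le> y" "y \<le> b" for y using left[of y] right[of y] that by fastforce
    qed (use a as sb in auto)
    then show False using a b gt by simp
  next
    case False
    define \<delta> where "\<delta> = f s - T"
    have \<delta>: "0 < \<delta>" using gt by (simp add: \<delta>_def)
    \<comment> \<open>The first entry gives \<open>exp (c * (b - s)) >= 2\<close>, so the
      denominator of \<open>kap\<close> is at least \<open>exp (c * b) / 2\<close>. The second gives
      \<open>2 * exp (c * s) / \<delta> <= c * b / 2\<close>, which is below
      \<open>exp (c * b / 2)\<close>.\<close>
    define b0 where "b0 = max (s + 1 / c) ((2 / c) * (2 * exp (c * s) / \<delta>))"
    have b0: "s + 1 / c \<le> b0" "(2 / c) * (2 * exp (c * s) / \<delta>) \<le> b0" by (simp_all add: b0_def)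
    have "0 \<le> b0" using b0(1) c assms by (meson add_nonneg_nonneg divide_nonneg_pos order_trans zero_le_one)
    then obtain b where b: "b0 \<le> b" "exp (- c * b) * (f b)\<^sup>2 \<le> 1"
      using frequently_below_exp[OF admissibleD(5)[OF adm]] by blast
    have "s < s + 1 / c" using c by simp
    then have sb: "s < b" using b0 b by linarith
    define z where "z = exp (c * b / 2)"
    have zz: "exp (c * b) = z * z" by (simp add: z_def exp_add[symmetric])
    have z0: "0 < z" by (simp add: z_def)
    have fb: "f b \<le> z"
    proof -
      have "(f b)\<^sup>2 \<le> exp (c * b)" using b(2) by (simp add: exp_minus field_simps)
      then have "(f b)\<^sup>2 \<le> z\<^sup>2" by (simp add: zz power2_eq_square)
      then show ?thesis by (rule power2_le_imp_le[OF _ less_imp_le[OF z0]])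
    qed
    have "f s \<le> f a + kap c a b s * (f b - f a)"
    proof (rule f_le_interpolation)
      show "T \<le> f y" if "a \<le> y" "y \<le> b" for y
        using left[of y] False that by (cases "y \<le> s") (auto simp: not_le intro: less_imp_le)
    qed (use a as sb in auto)
    then have "\<delta> \<le> kap c a b s * (f b - T)" using a by (simp add: \<delta>_def)
    also have "\<dots> \<le> kap c a b s * z"
      using fb T kap_bounds(1)[OF c, of a b s] as sb by (intro mult_left_mono) auto
    also have "\<dots> \<le> (exp (c * s) / (z * z / 2)) * z"
    proof (intro mult_right_mono)
      have "s + 1 / c \<le> b" using b(1) b0(1) by simp
      then have "1 \<le> c * (b - s)" using c by (simp add: field_simps)
      then have "2 \<le> exp (c * (b - s))" using exp_ge_add_one_self[of "c * (b - s)"] by linarith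
      then have "exp (c * s) \<le> exp (c * b) / 2" by (simp add: right_diff_distrib exp_diff field_simps)
      moreover have "exp (c * a) \<le> exp (c * s)" using c as by simp
      ultimately have "z * z / 2 \<le> exp (c * b) - exp (c * a)" using zz by linarith
      then show "kap c a b s \<le> exp (c * s) / (z * z / 2)"
        unfolding kap_def using z0 by (intro frac_le) auto
    qed (use z0 in simp)
    also have "\<dots> = 2 * exp (c * s) / z" using z0 by (simp add: field_simps)
    finally have "z \<le> 2 * exp (c * s) / \<delta>" using z0 \<delta> by (simp add: field_simps)
    also have "\<dots> \<le> c * b / 2"
    proof -
      have "(c / 2) * ((2 / c) * (2 * exp (c * s) / \<delta>)) \<le> (c / 2) * b"
        using b(1) b0(2) c by (intro mult_left_mono) auto
      then show ?thesis using c by simp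
    qed
    also have "\<dots> < z" unfolding z_def using exp_ge_add_one_self[of "c * b / 2"] by linarith
    finally show False by simp
  qed
qed

text \<open>At the first zero, compare with the larger of the values at the ends of a short symmetric interval:
  the reaction term is of higher order in the length and cannot pull \<open>f\<close> down to zero.\<close>

lemma f_pos:
  assumes "0 \<le> s" shows "0 < f s"
proof (rule ccontr)
  assume "\<not> 0 < f s"
  then have fs: "f s = 0" using f_nonneg[OF assms] by simp
  obtain y0 where y0: "0 \<le> y0" "f y0 = 0" and ymin: "\<And>y. 0 \<le> y \<Longrightarrow> y \<le> s \<Longrightarrow> f y = 0 \<Longrightarrow> y0 \<le> y" and y0s: "y0 \<le> s"
  proof -
    have "{y\<in>{0..s}. f y = 0} \<noteq> {}" using fs assms by auto
    from compact_attains_inf[OF level_compact this] show ?thesis by (auto intro: that)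
  qed
  have "0 < y0" using y0 admissibleD(1)[OF adm] T by (cases "y0 = 0") auto
  \<comment> \<open>A lower bound for both endpoint weights, valid for every radius up to 1.\<close>
  define k0 where "k0 = 1 / (exp c + 1)"
  have k0: "0 < k0" by (simp add: k0_def add_pos_pos)
  \<comment> \<open>The last entry is chosen so that \<open>4 * r0 * T ^ 3 < k0\<close>, which
    contradicts the final estimate.\<close>
  define r0 where "r0 = min (min 1 y0) (k0 / (4 * (T ^ 3 + 1)))"
  have T3: "0 < T ^ 3" using T by simp
  have r0: "0 < r0" "r0 \<le> 1" "r0 \<le> y0" "r0 \<le> k0 / (4 * (T ^ 3 + 1))"
    using \<open>0 < y0\<close> k0 T3 by (auto simp: r0_def add_pos_pos)
  obtain q where q: "q \<in> {y0 - r0..y0 + r0}" and qmax: "\<And>y. y \<in> {y0 - r0..y0 + r0} \<Longrightarrow> f y \<le> f q"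
    using continuous_attains_sup[OF compact_Icc _ f_continuous, of "y0 - r0" "y0 + r0"] r0 by fastforce
  define m where "m = f q"
  have "f (y0 - r0) \<noteq> 0" using ymin[of "y0 - r0"] r0 y0s by auto
  then have m: "0 < m" using qmax[of "y0 - r0"] f_nonneg[of "y0 - r0"] r0 by (auto simp: m_def)
  \<comment> \<open>With this radius the maximum point \<open>q\<close> is an endpoint, so
    \<open>m\<close> is an end value and also bounds \<open>f\<close> inside the interval.\<close>
  define r where "r = \<bar>q - y0\<bar>"
  have r: "0 < r" "r \<le> r0" using q m y0 by (auto simp: r_def m_def abs_le_iff)
  define a b where "a = y0 - r" and "b = y0 + r"
  have ab: "0 \<le> a" "a < b" "a \<le> y0" "y0 \<le> b" using r r0 by (auto simp: a_def b_def)
  define \<kappa> where "\<kappa> = kap c a b y0"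
  have \<kappa>_eq: "\<kappa> = 1 / (exp (c * r) + 1)" unfolding \<kappa>_def a_def b_def by (rule kap_symmetric[OF c r(1)])
  have "exp (c * r) \<le> exp c" using r r0 c by simp
  then have \<kappa>1: "k0 \<le> \<kappa>" unfolding \<kappa>_eq k0_def by (intro divide_left_mono) (auto intro!: mult_pos_pos add_pos_pos)
  have "1 - \<kappa> = exp (c * r) / (exp (c * r) + 1)"
    unfolding \<kappa>_eq by (simp add: field_simps add_pos_pos less_imp_neq[symmetric])
  moreover have "1 / (exp (c * r) + 1) \<le> exp (c * r) / (exp (c * r) + 1)"
    using c r by (intro divide_right_mono) auto
  ultimately have \<kappa>2: "k0 \<le> 1 - \<kappa>" using \<kappa>1 \<kappa>_eq by linarith
  have fa: "0 \<le> f a" "0 \<le> f b" using f_nonneg ab by auto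
  have "f a = m \<or> f b = m" by (auto simp: a_def b_def r_def m_def abs_if)
  then have low: "k0 * m \<le> (1 - \<kappa>) * f a + \<kappa> * f b"
  proof
    assume *: "f a = m"
    have "k0 * m \<le> (1 - \<kappa>) * m" using \<kappa>2 m by (intro mult_right_mono) auto
    moreover have "0 \<le> \<kappa> * f b" using \<kappa>1 k0 fa by (intro mult_nonneg_nonneg) auto
    ultimately show ?thesis using * by simp
  next
    assume *: "f b = m"
    have "k0 * m \<le> \<kappa> * m" using \<kappa>1 m by (intro mult_right_mono) auto
    moreover have "0 \<le> (1 - \<kappa>) * f a" using \<kappa>2 k0 fa by (intro mult_nonneg_nonneg) auto
    ultimately show ?thesis using * by simp
  qed
  have "(LINT y:{a..b}|lborel. exp (- c * y) * ((f y ^ 4 + g y) * green c a b y0 y)) \<le> (LINT y:{a..b}|lborel. m ^ 4 * (c * (b - a)))"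
    unfolding set_lebesgue_integral_def
  proof (rule integral_mono')
    show "integrable lborel (\<lambda>y. indicat_real {a..b} y *\<^sub>R (m ^ 4 * (c * (b - a))))"
      by (intro integrable_scaleR_left integrable_real_indicator) (auto simp: emeasure_lborel_Icc_eq)
    fix y
    show "0 \<le> indicat_real {a..b} y *\<^sub>R (m ^ 4 * (c * (b - a)))" using m c ab by simp
    show "indicat_real {a..b} y *\<^sub>R (exp (- c * y) * ((f y ^ 4 + g y) * green c a b y0 y))
      \<le> indicat_real {a..b} y *\<^sub>R (m ^ 4 * (c * (b - a)))"
    proof (cases "y \<in> {a..b}")
      case True
      then have y: "0 \<le> y" "f y \<le> m" using ab qmax[of y] r by (auto simp: m_def a_def b_def)
      have G: "0 \<le> exp (- c * y) * green c a b y0 y" using green_nonneg[OF c ab(2-4), of y] by simp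
      have "f y ^ 4 + g y \<le> m ^ 4" using g_le[OF y(1)] power_mono[OF y(2) f_nonneg[OF y(1)], of 4] by linarith
      then have "(f y ^ 4 + g y) * (exp (- c * y) * green c a b y0 y) \<le> m ^ 4 * (exp (- c * y) * green c a b y0 y)"
        using G by (rule mult_right_mono)
      also have "\<dots> \<le> m ^ 4 * (c * (b - a))"
        using green_weight_le[OF c ab(2-4) True] m by (intro mult_left_mono) auto
      finally show ?thesis using True by (simp add: mult.left_commute)
    qed simp
  qed
  also have "\<dots> = c * (4 * r\<^sup>2 * m ^ 4)"
    using r by (simp add: set_lebesgue_integral_def a_def b_def power2_eq_square)
  finally have "0 \<le> c * (f y0 - f a - \<kappa> * (f b - f a)) + c * (4 * r\<^sup>2 * m ^ 4)"
    using green_ineq[OF ab] by (simp add: \<kappa>_def)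
  then have "0 \<le> c * (4 * r\<^sup>2 * m ^ 4 - ((1 - \<kappa>) * f a + \<kappa> * f b))"
    using y0 by (simp add: algebra_simps)
  then have "(1 - \<kappa>) * f a + \<kappa> * f b \<le> 4 * r\<^sup>2 * m ^ 4" using c by (simp add: zero_le_mult_iff)
  with low have "k0 * m \<le> (4 * r\<^sup>2 * m ^ 3) * m" by (simp add: eval_nat_numeral mult.assoc)
  then have "k0 \<le> 4 * r\<^sup>2 * m ^ 3" using m by simp
  also have "\<dots> \<le> 4 * r0 * T ^ 3"
  proof -
    have "m \<le> T" unfolding m_def by (rule f_le_T) (use q r0 in auto)
    then have "m ^ 3 \<le> T ^ 3" using m by (intro power_mono) auto
    moreover have "r\<^sup>2 \<le> r0" using r r0 mult_mono[of r 1 r r0] by (simp add: power2_eq_square)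
    ultimately show ?thesis using m r0 by (intro mult_mono) auto
  qed
  also have "\<dots> \<le> 4 * (k0 / (4 * (T ^ 3 + 1))) * T ^ 3" using r0 T3 by (intro mult_right_mono mult_left_mono) auto
  also have "\<dots> = k0 * (T ^ 3 / (T ^ 3 + 1))"
  proof -
    have "4 * (k0 / (4 * w)) * t = k0 * (t / w)" for t w :: real by simp
    then show ?thesis .
  qed
  also have "\<dots> < k0 * 1"
  proof -
    have "t / (t + 1) < 1" if "0 < t" for t :: real using that by simp
    from this[OF T3] show ?thesis using k0 by (rule mult_strict_left_mono)
  qed
  finally show False by simp
qed

end


section \<open>The equation for the limit profile\<close>

definition emission :: "(real \<Rightarrow> real) \<Rightarrow> real \<Rightarrow> real" where
  "emission v \<eta> = indicator {0<..} \<eta> * v \<eta> ^ 4"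

lemma gsrc_eq_conv: "gsrc v y = - conv Ekern (emission v) y"
  unfolding gsrc_def conv_def emission_def set_lebesgue_integral_def
  by (auto intro!: Bochner_Integration.integral_cong)

lemma emission_measurable:
  assumes "set_borel_measurable lborel {0..} v"
  shows "emission v \<in> borel_measurable borel"
proof -
  have [measurable]: "(\<lambda>x. indicator {0..} x *\<^sub>R v x) \<in> borel_measurable borel"
    using assms by (simp add: set_borel_measurable_def)
  have "emission v = (\<lambda>x. indicator {0<..} x * (indicator {0..} x *\<^sub>R v x) ^ 4)"
    by (auto simp: emission_def indicator_def)
  also have "\<dots> \<in> borel_measurable borel" by measurable
  finally show ?thesis .
qed

lemma emission_bounds:
  assumes "\<And>y. 0 \<le> y \<Longrightarrow> 0 \<le> v y" "\<And>y. 0 \<le> y \<Longrightarrow> v y \<le> T" "0 \<le> T"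
  shows "0 \<le> emission v x" "emission v x \<le> T ^ 4" "\<bar>emission v x\<bar> \<le> T ^ 4"
  using assms(1)[of x] assms(2)[of x] assms(3) power_mono[of "v x" T 4]
  by (auto simp: emission_def indicator_def)

lemma conv_Ekern_bounds:
  assumes m: "u \<in> borel_measurable borel" and u: "\<And>x. 0 \<le> u x" "\<And>x. u x \<le> B"
  shows "0 \<le> conv Ekern u y" "conv Ekern u y \<le> B"
proof -
  have "\<bar>u x\<bar> \<le> B" for x using u[of x] by simp
  moreover have "0 \<le> B" using u[of 0] by linarith
  ultimately have "conv Ekern (\<lambda>_. 0) y \<le> conv Ekern u y" "conv Ekern u y \<le> conv Ekern (\<lambda>_. B) y"
    using m u by (auto intro!: conv_mono[where B=B] Ekern_integrable Ekern_nonneg)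
  then show "0 \<le> conv Ekern u y" "conv Ekern u y \<le> B" by (simp_all add: conv_const integral_Ekern)
qed

text \<open>Unit mass of \<open>Ekern\<close> turns bounds \<open>0 <= v <= T\<close> into the
  source bounds of the locale; the locale returns the same bounds for \<open>h\<close>, so they
  propagate along the iteration.\<close>

lemma minimizer_gsrc:
  assumes c: "0 < c" and T: "0 < T" and v: "set_borel_measurable lborel {0..} v"
    "\<And>y. 0 \<le> y \<Longrightarrow> 0 \<le> v y" "\<And>y. 0 \<le> y \<Longrightarrow> v y \<le> T"
    and h: "is_minimizer c T (gsrc v) h"
  shows "\<exists>h'. minimizer c T (gsrc v) h h'"
proof -
  note em = emission_measurable[OF v(1)] and eb = emission_bounds[OF v(2,3) less_imp_le[OF T]]
  note cb = conv_Ekern_bounds[OF em eb(1,2)]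
  have [measurable]: "conv Ekern (emission v) \<in> borel_measurable borel"
    by (rule conv_measurable[OF Ekern_measurable em])
  obtain h' where "admissible c T h h'" "\<forall>k k'. admissible c T k k' \<longrightarrow> energy c (gsrc v) h h' \<le> energy c (gsrc v) k k'"
    using h by (auto simp: is_minimizer_def)
  moreover have "set_borel_measurable lborel {0..} (gsrc v)"
    unfolding gsrc_eq_conv[abs_def] set_borel_measurable_def by measurable
  ultimately have "minimizer c T (gsrc v) h h'"
    using c T cb by unfold_locales (auto simp: gsrc_eq_conv)
  then show ?thesis by blast
qed

lemma conv_Ekern_emission_tendsto:
  assumes T: "0 \<le> T" and m: "\<And>n. set_borel_measurable lborel {0..} (v n)" "set_borel_measurable lborel {0..} w"
    and b: "\<And>n y. 0 \<le> y \<Longrightarrow> 0 \<le> v n y" "\<And>n y. 0 \<le> y \<Longrightarrow> v n y \<le> T"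
    and lim: "\<And>y. 0 \<le> y \<Longrightarrow> (\<lambda>n. v n y) \<longlonglongrightarrow> w y"
  shows "(\<lambda>n. conv Ekern (emission (v n)) y) \<longlonglongrightarrow> conv Ekern (emission w) y"
  unfolding conv_def
proof (rule integral_dominated_convergence)
  note [measurable] = emission_measurable[OF m(1)] emission_measurable[OF m(2)]
  show "(\<lambda>\<eta>. Ekern (y - \<eta>) * emission w \<eta>) \<in> borel_measurable lborel" by measurable
  show "(\<lambda>\<eta>. Ekern (y - \<eta>) * emission (v n) \<eta>) \<in> borel_measurable lborel" for n by measurable
  show "integrable lborel (\<lambda>\<eta>. Ekern (y - \<eta>) * T ^ 4)"
    using conv_integrable(1)[OF Ekern_integrable, of "\<lambda>_. T ^ 4" "T ^ 4" y] T by simp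
  show "AE \<eta> in lborel. (\<lambda>n. Ekern (y - \<eta>) * emission (v n) \<eta>) \<longlonglongrightarrow> Ekern (y - \<eta>) * emission w \<eta>"
  proof (rule AE_I2)
    fix \<eta> :: real
    have "(\<lambda>n. emission (v n) \<eta>) \<longlonglongrightarrow> emission w \<eta>"
    proof (cases "0 < \<eta>")
      case True
      then show ?thesis unfolding emission_def by (intro tendsto_intros lim) simp
    qed (simp add: emission_def)
    then show "(\<lambda>n. Ekern (y - \<eta>) * emission (v n) \<eta>) \<longlonglongrightarrow> Ekern (y - \<eta>) * emission w \<eta>"
      by (intro tendsto_intros)
  qed
  show "AE \<eta> in lborel. norm (Ekern (y - \<eta>) * emission (v n) \<eta>) \<le> Ekern (y - \<eta>) * T ^ 4" for n
    using emission_bounds[OF b T] Ekern_nonneg by (intro AE_I2) (auto simp: abs_mult intro!: mult_left_mono)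
qed

text \<open>The Green form involves only point values and one integral, so pointwise convergence and
  a uniform bound suffice; no derivative has to converge. The indices \<open>Suc n\<close> in the
  power and \<open>n\<close> in the source share the limit \<open>f\<close>.\<close>

lemma limit_green_equation:
  fixes TM c :: real and fs :: "nat \<Rightarrow> real \<Rightarrow> real" and f :: "real \<Rightarrow> real"
  assumes TM: "TM > 0" and c: "c > 0"
    and f0: "fs 0 = (\<lambda>y. 0)"
    and min: "\<And>n. is_minimizer c TM (gsrc (fs n)) (fs (Suc n))"
    and lim: "\<And>y. y \<ge> 0 \<Longrightarrow> (\<lambda>n. fs n y) \<longlonglongrightarrow> f y"
  shows "set_borel_measurable lborel {0..} f" "\<And>y. 0 \<le> y \<Longrightarrow> 0 \<le> f y" "\<And>y. 0 \<le> y \<Longrightarrow> f y \<le> TM"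
    "\<And>R s. 0 < R \<Longrightarrow> 0 \<le> s \<Longrightarrow> s \<le> R \<Longrightarrow> c * (f s - TM - kap c 0 R s * (f R - TM)) +
       (LINT y:{0..R}|lborel. exp (- c * y) * ((f y ^ 4 - conv Ekern (emission f) y) * green c 0 R s y)) = 0"
proof -
  \<comment> \<open>Strict positivity cannot belong to the invariant, since \<open>fs 0\<close> is
    zero; it is used later for \<open>fs (Suc n)\<close> alone.\<close>
  have P: "set_borel_measurable lborel {0..} (fs n) \<and> (\<forall>y\<ge>0. 0 \<le> fs n y \<and> fs n y \<le> TM)" for n
  proof (induction n)
    case 0
    then show ?case using TM by (simp add: f0 set_borel_measurable_def)
  next
    case (Suc n)
    then obtain h' where "minimizer c TM (gsrc (fs n)) (fs (Suc n)) h'"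
      using minimizer_gsrc[OF c TM _ _ _ min] by blast
    then interpret minimizer c TM "gsrc (fs n)" "fs (Suc n)" h' .
    show ?case
      using f_nonneg f_le_T set_borel_measurable_continuous_atLeast[OF admissible_continuous[OF adm]] by blast
  qed
  have m: "set_borel_measurable lborel {0..} (fs n)" and nn: "0 \<le> y \<Longrightarrow> 0 \<le> fs n y" and le: "0 \<le> y \<Longrightarrow> fs n y \<le> TM" for n y
    using P[of n] by auto
  show mf: "set_borel_measurable lborel {0..} f"
    unfolding set_borel_measurable_def
  proof (rule borel_measurable_LIMSEQ_real)
    show "(\<lambda>n. indicat_real {0..} x *\<^sub>R fs n x) \<longlonglongrightarrow> indicat_real {0..} x *\<^sub>R f x" for x
      by (cases "0 \<le> x") (auto intro!: tendsto_intros lim)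
    show "(\<lambda>x. indicat_real {0..} x *\<^sub>R fs n x) \<in> borel_measurable lborel" for n
      using m[of n] by (simp add: set_borel_measurable_def)
  qed
  show fnn: "0 \<le> f y" if "0 \<le> y" for y
    by (rule LIMSEQ_le_const[OF lim[OF that]]) (use nn that in auto)
  show fle: "f y \<le> TM" if "0 \<le> y" for y
    by (rule LIMSEQ_le_const2[OF lim[OF that]]) (use le that in auto)
  fix R s :: real assume R: "0 < R" and s: "0 \<le> s" "s \<le> R"
  let ?S = "\<lambda>n y. exp (- c * y) * ((fs (Suc n) y ^ 4 + gsrc (fs n) y) * green c 0 R s y)"
  let ?L = "\<lambda>y. exp (- c * y) * ((f y ^ 4 - conv Ekern (emission f) y) * green c 0 R s y)"
  have eq: "c * (fs (Suc n) s - TM - kap c 0 R s * (fs (Suc n) R - TM)) + (LINT y:{0..R}|lborel. ?S n y) = 0" for n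
  proof -
    obtain h' where "minimizer c TM (gsrc (fs n)) (fs (Suc n)) h'"
      using minimizer_gsrc[OF c TM m nn le min] by blast
    then interpret minimizer c TM "gsrc (fs n)" "fs (Suc n)" h' .
    show ?thesis
      using green_eq[of 0 R s] f_pos R s admissibleD(1)[OF adm] by auto
  qed
  have em: "emission (fs n) \<in> borel_measurable borel" "emission f \<in> borel_measurable borel" for n
    by (rule emission_measurable, rule m mf)+
  have [measurable]: "conv Ekern (emission (fs n)) \<in> borel_measurable borel" "conv Ekern (emission f) \<in> borel_measurable borel" for n
    by (intro conv_measurable em Ekern_measurable)+
  have [measurable]: "green c 0 R s \<in> borel_measurable borel"
    by (rule borel_measurable_continuous_onI[OF green_continuous[OF c R s]])
  have [measurable]: "(\<lambda>y. indicat_real {0..} y *\<^sub>R fs n y) \<in> borel_measurable borel"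
      "(\<lambda>y. indicat_real {0..} y *\<^sub>R f y) \<in> borel_measurable borel" for n
    using m mf by (simp_all add: set_borel_measurable_def)
  have "(\<lambda>n. LINT y:{0..R}|lborel. ?S n y) \<longlonglongrightarrow> (LINT y:{0..R}|lborel. ?L y)"
    unfolding set_lebesgue_integral_def
  proof (rule integral_dominated_convergence)
    have "(\<lambda>y. indicat_real {0..R} y *\<^sub>R ?L y) = (\<lambda>y. indicat_real {0..R} y *\<^sub>R (exp (- c * y) *
        (((indicat_real {0..} y *\<^sub>R f y) ^ 4 - conv Ekern (emission f) y) * green c 0 R s y)))"
      by (auto simp: indicator_def)
    also have "\<dots> \<in> borel_measurable lborel" by measurable
    finally show "(\<lambda>y. indicat_real {0..R} y *\<^sub>R ?L y) \<in> borel_measurable lborel" .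
    fix n
    have "(\<lambda>y. indicat_real {0..R} y *\<^sub>R ?S n y) = (\<lambda>y. indicat_real {0..R} y *\<^sub>R (exp (- c * y) *
        (((indicat_real {0..} y *\<^sub>R fs (Suc n) y) ^ 4 - conv Ekern (emission (fs n)) y) * green c 0 R s y)))"
      by (auto simp: indicator_def gsrc_eq_conv)
    also have "\<dots> \<in> borel_measurable lborel" by measurable
    finally show "(\<lambda>y. indicat_real {0..R} y *\<^sub>R ?S n y) \<in> borel_measurable lborel" .
    show "AE y in lborel. norm (indicat_real {0..R} y *\<^sub>R ?S n y) \<le> indicat_real {0..R} y *\<^sub>R (TM ^ 4 * exp (c * R))"
    proof (rule AE_I2)
      fix y
      show "norm (indicat_real {0..R} y *\<^sub>R ?S n y) \<le> indicat_real {0..R} y *\<^sub>R (TM ^ 4 * exp (c * R))"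
      proof (cases "y \<in> {0..R}")
        case True
        have "0 \<le> fs (Suc n) y ^ 4" "fs (Suc n) y ^ 4 \<le> TM ^ 4"
          using True nn[of y "Suc n"] le[of y "Suc n"] by (auto intro!: power_mono)
        moreover have "gsrc (fs n) y \<le> 0" "- (TM ^ 4) \<le> gsrc (fs n) y"
          using conv_Ekern_bounds[OF em(1)[of n] emission_bounds(1,2)[OF nn le], of y] TM by (auto simp: gsrc_eq_conv)
        ultimately have 1: "\<bar>fs (Suc n) y ^ 4 + gsrc (fs n) y\<bar> \<le> TM ^ 4" by linarith
        have 2: "\<bar>green c 0 R s y\<bar> \<le> exp (c * R)"
          using green_nonneg[OF c R s, of y] green_le[OF c R s, of y] by simp
        have 3: "\<bar>exp (- c * y)\<bar> \<le> 1" using c True by simp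
        have "norm (?S n y) \<le> 1 * (TM ^ 4 * exp (c * R))"
          unfolding real_norm_def abs_mult using 1 2 3 TM by (intro mult_mono) auto
        then show ?thesis using True by simp
      qed simp
    qed
  next
    show "integrable lborel (\<lambda>y. indicat_real {0..R} y *\<^sub>R (TM ^ 4 * exp (c * R)))"
      by (rule integrable_indicator_Icc)
    show "AE y in lborel. (\<lambda>n. indicat_real {0..R} y *\<^sub>R ?S n y) \<longlonglongrightarrow> indicat_real {0..R} y *\<^sub>R ?L y"
    proof (rule AE_I2)
      fix y
      show "(\<lambda>n. indicat_real {0..R} y *\<^sub>R ?S n y) \<longlonglongrightarrow> indicat_real {0..R} y *\<^sub>R ?L y"
      proof (cases "y \<in> {0..R}")
        case True
        then have "(\<lambda>n. fs (Suc n) y) \<longlonglongrightarrow> f y" by (intro LIMSEQ_Suc lim) simp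
        moreover have "(\<lambda>n. conv Ekern (emission (fs n)) y) \<longlonglongrightarrow> conv Ekern (emission f) y"
          by (rule conv_Ekern_emission_tendsto[OF less_imp_le[OF TM] m mf nn le lim])
        ultimately have "(\<lambda>n. exp (- c * y) * ((fs (Suc n) y ^ 4 + - conv Ekern (emission (fs n)) y) * green c 0 R s y))
            \<longlonglongrightarrow> exp (- c * y) * ((f y ^ 4 + - conv Ekern (emission f) y) * green c 0 R s y)"
          by (intro tendsto_intros)
        then show ?thesis using True by (simp add: gsrc_eq_conv)
      qed simp
    qed
  qed
  moreover have "(\<lambda>n. fs (Suc n) s) \<longlonglongrightarrow> f s" "(\<lambda>n. fs (Suc n) R) \<longlonglongrightarrow> f R"
    using s R by (auto intro!: LIMSEQ_Suc lim)
  ultimately have "(\<lambda>n. c * (fs (Suc n) s - TM - kap c 0 R s * (fs (Suc n) R - TM)) + (LINT y:{0..R}|lborel. ?S n y))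
      \<longlonglongrightarrow> c * (f s - TM - kap c 0 R s * (f R - TM)) + (LINT y:{0..R}|lborel. ?L y)"
    by (intro tendsto_intros)
  then show "c * (f s - TM - kap c 0 R s * (f R - TM)) + (LINT y:{0..R}|lborel. ?L y) = 0"
    unfolding eq by (simp add: LIMSEQ_const_iff)
qed


section \<open>From the integral equation to the differential equation\<close>

lemma at_within_Icc_eq_atLeast:
  fixes s :: real
  assumes "0 \<le> s" "s < R" shows "at s within {0..R} = at s within {0..}"
  by (rule at_within_nhd[where S="{s-1<..<R}"]) (use assms in auto)

locale limit_profile =
  fixes c T :: real and f :: "real \<Rightarrow> real"
  assumes c: "0 < c" and T: "0 < T" and fm: "set_borel_measurable lborel {0..} f"
    and f_nonneg: "\<And>y. 0 \<le> y \<Longrightarrow> 0 \<le> f y" and f_le: "\<And>y. 0 \<le> y \<Longrightarrow> f y \<le> T"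
    and green: "\<And>R s. 0 < R \<Longrightarrow> 0 \<le> s \<Longrightarrow> s \<le> R \<Longrightarrow> c * (f s - T - kap c 0 R s * (f R - T)) +
       (LINT y:{0..R}|lborel. exp (- c * y) * ((f y ^ 4 - conv Ekern (emission f) y) * green c 0 R s y)) = 0"
begin

abbreviation "u \<equiv> emission f"

definition "h y = f y ^ 4 - conv Ekern u y"
text \<open>\<open>I1\<close> and \<open>H\<close> arise by splitting the Green integral at its
  pole: the weighted ramp equals \<open>1 - exp (- c * y)\<close> up to \<open>s\<close> and
  \<open>(exp (c * s) - 1) * exp (- c * y)\<close> beyond it.\<close>

definition "I1 s = integral {0..s} (\<lambda>y. (1 - exp (- c * y)) * h y)"
definition "H s = integral {0..s} (\<lambda>y. exp (- c * y) * h y)"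

lemma u_measurable [measurable]: "u \<in> borel_measurable borel"
  by (rule emission_measurable[OF fm])

lemma u_bounds: "0 \<le> u x" "u x \<le> T ^ 4" "\<bar>u x\<bar> \<le> T ^ 4"
  using T f_nonneg f_le by (auto intro!: emission_bounds)

lemma conv_E_measurable [measurable]: "conv Ekern u \<in> borel_measurable borel"
  by (intro conv_measurable Ekern_measurable u_measurable)

lemma conv_E_bounds: "0 \<le> conv Ekern u y" "conv Ekern u y \<le> T ^ 4"
  by (rule conv_Ekern_bounds[OF u_measurable u_bounds(1,2)])+

lemma h_abs: assumes "0 \<le> y" shows "\<bar>h y\<bar> \<le> T ^ 4"
proof -
  have "0 \<le> f y ^ 4" "f y ^ 4 \<le> T ^ 4" using f_nonneg[OF assms] f_le[OF assms] by (auto intro!: power_mono)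
  then show ?thesis using conv_E_bounds[of y] unfolding h_def by linarith
qed

lemma h_measurable: "set_borel_measurable lborel {0..} h"
proof -
  have [measurable]: "(\<lambda>y. indicat_real {0..} y *\<^sub>R f y) \<in> borel_measurable borel"
    using fm by (simp add: set_borel_measurable_def)
  have "(\<lambda>y. indicat_real {0..} y *\<^sub>R h y) = (\<lambda>y. indicat_real {0..} y *\<^sub>R ((indicat_real {0..} y *\<^sub>R f y) ^ 4 - conv Ekern u y))"
    by (auto simp: h_def indicator_def)
  also have "\<dots> \<in> borel_measurable lborel" by measurable
  finally show ?thesis by (simp add: set_borel_measurable_def)
qed

lemma h_set_integrable:
  assumes "0 \<le> a" shows "set_integrable lborel {a..b} h"
proof (rule set_integrable_bounded_Icc[where M="T ^ 4"])
  show "set_borel_measurable lborel {a..b} h"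
    by (rule set_borel_measurable_subset[OF h_measurable]) (use assms in auto)
qed (use h_abs assms in auto)

lemma mult_h_set_integrable:
  assumes "0 \<le> a" "continuous_on {a..b} w"
  shows "set_integrable lborel {a..b} (\<lambda>y. w y * h y)"
proof -
  have "compact (w ` {a..b})" by (intro compact_continuous_image assms compact_Icc)
  then obtain M where "\<forall>x\<in>w ` {a..b}. norm x \<le> M"
    using compact_imp_bounded[of "w ` {a..b}"] unfolding bounded_iff by blast
  then have "\<bar>w x\<bar> \<le> M" if "x \<in> {a..b}" for x using that by simp
  moreover have "set_borel_measurable lborel {a..b} w"
    using borel_measurable_continuous_on_indicator[OF _ assms(2)] by (simp add: set_borel_measurable_def)
  ultimately show ?thesis by (intro set_integrable_mult_bounded h_set_integrable assms) auto
qed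

lemmas mult_h_integrable = set_borel_integral_eq_integral(1)[OF mult_h_set_integrable]

lemma green_integral:
  assumes R: "0 < R" and s: "0 \<le> s" "s \<le> R"
  shows "(LINT y:{0..R}|lborel. exp (- c * y) * (h y * green c 0 R s y))
    = I1 s + (exp (c * s) - 1) * (H R - H s) - kap c 0 R s * I1 R"
proof -
  have e: "exp (- c * y) * exp (c * y) = 1" for y by (simp add: exp_add[symmetric])
  have iE: "(\<lambda>y. exp (- c * y) * h y) integrable_on {a..b}" if "0 \<le> a" for a b
    by (intro mult_h_integrable continuous_intros that)
  have i1: "(\<lambda>y. (1 - exp (- c * y)) * h y) integrable_on {a..b}" if "0 \<le> a" for a b
    by (intro mult_h_integrable continuous_intros that)
  have HR: "integral {s..R} (\<lambda>y. exp (- c * y) * h y) = H R - H s"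
    using Henstock_Kurzweil_Integration.integral_combine[OF s iE[of 0 R]] by (simp add: H_def)
  have A: "((\<lambda>y. exp (- c * y) * (h y * ramp c 0 s y)) has_integral I1 s + (exp (c * s) - 1) * (H R - H s)) {0..R}"
  proof (rule has_integral_combine[OF s])
    have "((\<lambda>y. (1 - exp (- c * y)) * h y) has_integral I1 s) {0..s}"
      unfolding I1_def by (intro integrable_integral i1) simp
    then show "((\<lambda>y. exp (- c * y) * (h y * ramp c 0 s y)) has_integral I1 s) {0..s}"
    proof (rule has_integral_eq[rotated])
      fix y assume "y \<in> {0..s}"
      then have "exp (- c * y) * (h y * ramp c 0 s y) = (exp (- c * y) * exp (c * y) - exp (- c * y)) * h y"
        by (simp add: ramp_def algebra_simps)
      then show "(1 - exp (- c * y)) * h y = exp (- c * y) * (h y * ramp c 0 s y)" unfolding e by (rule sym)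
    qed
    have "((\<lambda>y. (exp (c * s) - 1) * (exp (- c * y) * h y)) has_integral (exp (c * s) - 1) * (H R - H s)) {s..R}"
      unfolding HR[symmetric] by (intro has_integral_mult_right integrable_integral iE s)
    then show "((\<lambda>y. exp (- c * y) * (h y * ramp c 0 s y)) has_integral (exp (c * s) - 1) * (H R - H s)) {s..R}"
      by (rule has_integral_eq[rotated]) (use s in \<open>simp add: ramp_def mult.commute mult.left_commute\<close>)
  qed
  have B: "((\<lambda>y. exp (- c * y) * (h y * ramp c 0 R y)) has_integral I1 R) {0..R}"
  proof -
    have "((\<lambda>y. (1 - exp (- c * y)) * h y) has_integral I1 R) {0..R}"
      unfolding I1_def by (intro integrable_integral i1) simp
    then show ?thesis
    proof (rule has_integral_eq[rotated])
      fix y assume "y \<in> {0..R}"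
      then have "exp (- c * y) * (h y * ramp c 0 R y) = (exp (- c * y) * exp (c * y) - exp (- c * y)) * h y"
        by (simp add: ramp_def algebra_simps)
      then show "(1 - exp (- c * y)) * h y = exp (- c * y) * (h y * ramp c 0 R y)" unfolding e by (rule sym)
    qed
  qed
  have "((\<lambda>y. exp (- c * y) * (h y * ramp c 0 s y) - kap c 0 R s * (exp (- c * y) * (h y * ramp c 0 R y))) has_integral
      I1 s + (exp (c * s) - 1) * (H R - H s) - kap c 0 R s * I1 R) {0..R}"
    by (intro has_integral_diff has_integral_mult_right A B)
  then have v: "integral {0..R} (\<lambda>y. exp (- c * y) * (h y * green c 0 R s y)) = I1 s + (exp (c * s) - 1) * (H R - H s) - kap c 0 R s * I1 R"
  proof (intro integral_unique, elim has_integral_eq[rotated])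
    show "exp (- c * y) * (h y * ramp c 0 s y) - kap c 0 R s * (exp (- c * y) * (h y * ramp c 0 R y))
      = exp (- c * y) * (h y * green c 0 R s y)" for y
      unfolding green_def by (simp only: right_diff_distrib mult.left_commute[of "kap c 0 R s"])
  qed
  have "set_integrable lborel {0..R} (\<lambda>y. (exp (- c * y) * green c 0 R s y) * h y)"
    by (intro mult_h_set_integrable continuous_intros green_continuous[OF c R s]) simp
  then have "set_integrable lborel {0..R} (\<lambda>y. exp (- c * y) * (h y * green c 0 R s y))"
    by (simp add: mult_ac)
  then show ?thesis using v by (simp add: set_borel_integral_eq_integral(2))
qed

text \<open>Solved for \<open>f s\<close>, the Green equation depends on \<open>R\<close> only
  through one coefficient of \<open>exp (c * s) - 1\<close>. Representations for different
  \<open>R\<close> must agree at a common \<open>s > 0\<close>, so that coefficient is a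
  constant.\<close>

lemma variation_of_constants:
  obtains C where "\<And>s. 0 \<le> s \<Longrightarrow> f s = T + C * (exp (c * s) - 1) - I1 s / c + (exp (c * s) - 1) * H s / c"
proof -
  define CR where "CR R = ((f R - T) + I1 R / c) / (exp (c * R) - 1) - H R / c" for R
  have rep: "f s = T + CR R * (exp (c * s) - 1) - I1 s / c + (exp (c * s) - 1) * H s / c"
    if R: "0 < R" and s: "0 \<le> s" "s \<le> R" for R s
  proof -
    have d: "exp (c * R) - 1 \<noteq> 0" using c R by simp
    define D where "D = exp (c * R) - 1"
    define k where "k = (exp (c * s) - 1) / D"
    have kap: "kap c 0 R s = k" by (simp add: kap_def k_def D_def)
    have k: "exp (c * s) - 1 = k * D" using d by (simp add: k_def D_def)
    have "c * (f s - T - k * (f R - T)) + (I1 s + (k * D) * (H R - H s) - k * I1 R) = 0"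
      using green[OF R s] green_integral[OF R s] by (simp add: h_def kap k)
    then have "f s = T + k * (f R - T) - (I1 s + (k * D) * (H R - H s) - k * I1 R) / c"
      using c by (simp add: field_simps)
    also have "\<dots> = T + (((f R - T) + I1 R / c) / D - H R / c) * (k * D) - I1 s / c + (k * D) * H s / c"
      using d c unfolding D_def[symmetric] by (simp add: field_simps)
    finally show ?thesis by (simp only: CR_def k D_def[symmetric])
  qed
  \<comment> \<open>Comparison at \<open>s = 1\<close>, where \<open>exp c - 1\<close> is nonzero,
    identifies the coefficients.\<close>
  have C: "CR R = CR 1" if "1 \<le> R" for R
  proof -
    have "CR R * (exp (c * 1) - 1) = CR 1 * (exp (c * 1) - 1)"
      using rep[of R 1] rep[of 1 1] that by linarith
    then show ?thesis using c by simp
  qed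
  show ?thesis
  proof (rule that[of "CR 1"])
    fix s :: real assume "0 \<le> s"
    then show "f s = T + CR 1 * (exp (c * s) - 1) - I1 s / c + (exp (c * s) - 1) * H s / c"
      using rep[of "max s 1" s] C[of "max s 1"] by simp
  qed
qed

text \<open>Start of the regularity bootstrap: \<open>f\<close> is so far only measurable and
  bounded, but the representation expresses it by indefinite integrals. Continuity of
  \<open>f\<close> makes \<open>h\<close> continuous, and then the representation can be
  differentiated.\<close>

lemma f_continuous: "continuous_on {0..} f"
proof (rule continuous_on_atLeast_0I)
  fix R :: real assume "0 < R"
  obtain C where C: "\<And>s. 0 \<le> s \<Longrightarrow> f s = T + C * (exp (c * s) - 1) - I1 s / c + (exp (c * s) - 1) * H s / c"
    using variation_of_constants by blast
  have "continuous_on {0..R} (\<lambda>s. T + C * (exp (c * s) - 1) - I1 s / c + (exp (c * s) - 1) * H s / c)"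
    unfolding I1_def H_def
    by (intro continuous_intros indefinite_integral_continuous_1 mult_h_integrable) (use c in auto)
  then show "continuous_on {0..R} f"
    by (rule continuous_on_eq) (use C in auto)
qed

lemma f_isCont: "0 < y \<Longrightarrow> isCont f y"
  using continuous_on_interior[OF f_continuous, of y] by (simp add: interior_Ici[of "-1"])

lemma u_isCont:
  assumes "z \<noteq> 0" shows "isCont u z"
proof (cases "0 < z")
  case True
  have "isCont (\<lambda>x. f x ^ 4) z" by (intro continuous_intros f_isCont True)
  moreover have "eventually (\<lambda>x. f x ^ 4 = u x) (nhds z)"
    using eventually_nhds_in_open[of "{0<..}" z] True by (auto elim!: eventually_mono simp: emission_def)
  ultimately show ?thesis using isCont_cong[of "\<lambda>x. f x ^ 4" u z] by simp
next
  case False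
  have "eventually (\<lambda>x. 0 = u x) (nhds z)"
    using eventually_nhds_in_open[of "{..<0}" z] False assms by (auto elim!: eventually_mono simp: emission_def)
  then show ?thesis using isCont_cong[of "\<lambda>_. 0" u z] by simp
qed

lemma conv_E_continuous: "continuous_on UNIV (conv Ekern u)"
  unfolding continuous_on_sequentially
proof (intro allI ballI impI, elim conjE)
  fix Y :: "nat \<Rightarrow> real" and y assume Y: "Y \<longlonglongrightarrow> y"
  show "(conv Ekern u \<circ> Y) \<longlonglongrightarrow> conv Ekern u y"
    unfolding o_def conv_commute
  proof (rule integral_dominated_convergence)
    show "integrable lborel (\<lambda>x. Ekern x * T ^ 4)" by (intro integrable_mult_left Ekern_integrable)
    show "AE x in lborel. norm (Ekern x * u (Y n - x)) \<le> Ekern x * T ^ 4" for n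
      using u_bounds Ekern_nonneg by (intro AE_I2) (auto simp: abs_mult intro!: mult_left_mono)
    \<comment> \<open>The excluded point is where the argument of \<open>u\<close> hits 0, the only
      possible discontinuity of \<open>u\<close>.\<close>
    have "AE x in lborel. x \<noteq> y" by (rule AE_lborel_singleton)
    then show "AE x in lborel. (\<lambda>n. Ekern x * u (Y n - x)) \<longlonglongrightarrow> Ekern x * u (y - x)"
      by eventually_elim (intro tendsto_intros isCont_tendsto_compose[OF u_isCont] Y, simp)
  qed measurable
qed

lemma h_continuous: "continuous_on {0..} h"
  unfolding h_def[abs_def]
  by (intro continuous_intros f_continuous continuous_on_subset[OF conv_E_continuous]) simp

lemma integral_0_deriv:
  assumes w: "continuous_on {0..} w" and s: "0 \<le> (s::real)"
  shows "((\<lambda>x. integral {0..x} w) has_real_derivative w s) (at s within {0..})"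
proof -
  have "((\<lambda>x. integral {0..x} w) has_real_derivative w s) (at s within {0..s+1})"
    by (rule integral_has_real_derivative) (use s in \<open>auto intro: continuous_on_subset[OF w]\<close>)
  then show ?thesis using at_within_Icc_eq_atLeast[of s "s+1"] s by simp
qed

text \<open>On differentiating the representation the two terms containing \<open>h\<close> cancel,
  leaving \<open>exp (c * s) * (c * C + H s)\<close>; this can be differentiated once more.\<close>

lemma profile_ode:
  obtains p where "\<And>s. 0 \<le> s \<Longrightarrow> (f has_real_derivative p s) (at s within {0..})"
    "\<And>s. 0 \<le> s \<Longrightarrow> (p has_real_derivative c * p s + h s) (at s within {0..})"
proof -
  obtain C where C: "\<And>s. 0 \<le> s \<Longrightarrow> f s = T + C * (exp (c * s) - 1) - I1 s / c + (exp (c * s) - 1) * H s / c"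
    using variation_of_constants by blast
  have dI: "(I1 has_real_derivative (1 - exp (- c * s)) * h s) (at s within {0..})" if "0 \<le> s" for s
    unfolding I1_def[abs_def] by (rule integral_0_deriv) (use that in \<open>auto intro!: continuous_intros h_continuous\<close>)
  have dH: "(H has_real_derivative exp (- c * s) * h s) (at s within {0..})" if "0 \<le> s" for s
    unfolding H_def[abs_def] by (rule integral_0_deriv) (use that in \<open>auto intro!: continuous_intros h_continuous\<close>)
  have e: "exp (c * s) * (exp (- c * s) * x) = x" for s x
    by (simp add: mult.assoc[symmetric] exp_add[symmetric])
  show ?thesis
  proof (rule that[of "\<lambda>s. exp (c * s) * (c * C + H s)"])
    fix s :: real assume s: "0 \<le> s"
    have "((\<lambda>s. T + C * (exp (c * s) - 1) - I1 s / c + (exp (c * s) - 1) * H s / c) has_real_derivative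
        (C * (exp (c * s) * c) - (1 - exp (- c * s)) * h s / c + (exp (c * s) * c * H s + (exp (c * s) - 1) * (exp (- c * s) * h s)) / c)) (at s within {0..})"
      by (rule derivative_eq_intros dI[OF s] dH[OF s] refl | use c in \<open>simp; fail\<close>)+
    also have "C * (exp (c * s) * c) - (1 - exp (- c * s)) * h s / c + (exp (c * s) * c * H s + (exp (c * s) - 1) * (exp (- c * s) * h s)) / c
        = exp (c * s) * (c * C + H s)"
    proof -
      have "(exp (c * s) - 1) * (exp (- c * s) * h s) = h s - exp (- c * s) * h s"
        unfolding left_diff_distrib e by simp
      then show ?thesis using c by (simp add: field_simps)
    qed
    finally show "(f has_real_derivative exp (c * s) * (c * C + H s)) (at s within {0..})"
      by (rule has_field_derivative_transform_within[where d=1]) (use C s in auto)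
    have "((\<lambda>s. exp (c * s) * (c * C + H s)) has_real_derivative
        exp (c * s) * c * (c * C + H s) + exp (c * s) * (exp (- c * s) * h s)) (at s within {0..})"
      by (rule derivative_eq_intros dH[OF s] refl | simp; fail)+
    then show "((\<lambda>s. exp (c * s) * (c * C + H s)) has_real_derivative c * (exp (c * s) * (c * C + H s)) + h s) (at s within {0..})"
      unfolding e by (simp only: mult_ac)
  qed
qed

end


section \<open>Behaviour at infinity\<close>

text \<open>Equality holds at \<open>a = b\<close>, so the difference of the two sides contains the
  square of \<open>a - b\<close>; the cofactor has nonnegative coefficients.\<close>

lemma young_5_4:
  fixes a b :: real
  assumes "0 \<le> a" "0 \<le> b"
  shows "a * b ^ 4 \<le> a ^ 5 / 5 + 4 / 5 * b ^ 5"
proof -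
  have "0 \<le> (a - b)\<^sup>2 * (a ^ 3 + 2 * a\<^sup>2 * b + 3 * a * b\<^sup>2 + 4 * b ^ 3)"
    using assms by (intro mult_nonneg_nonneg add_nonneg_nonneg) auto
  also have "\<dots> = a ^ 5 + 4 * b ^ 5 - 5 * (a * b ^ 4)" by algebra
  finally show ?thesis by simp
qed

lemma has_integral_deriv_atLeast:
  fixes F F' :: "real \<Rightarrow> real"
  assumes "\<And>s. 0 \<le> s \<Longrightarrow> (F has_real_derivative F' s) (at s within {0..})" "0 \<le> a" "a \<le> b"
  shows "(F' has_integral F b - F a) {a..b}"
proof (rule fundamental_theorem_of_calculus[OF assms(3)])
  fix x assume "x \<in> {a..b}"
  then have "(F has_real_derivative F' x) (at x within {a..b})"
    using assms(2) by (intro DERIV_subset[OF assms(1)]) auto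
  then show "(F has_vector_derivative F' x) (at x within {a..b})"
    by (simp add: has_real_derivative_iff_has_vector_derivative)
qed

lemma set_integral_has_integral:
  fixes k :: "real \<Rightarrow> real"
  assumes "set_integrable lborel A k"
  shows "(k has_integral (LINT x:A|lborel. k x)) A"
  using set_borel_integral_eq_integral[OF assms] by (simp add: integrable_integral)

lemma conv_scale: "conv k (\<lambda>\<eta>. a * w \<eta>) y = a * conv k w y"
  unfolding conv_def by (simp add: mult.left_commute)

lemma conv_add:
  assumes "integrable lborel k" "v \<in> borel_measurable borel" "\<And>x. \<bar>v x\<bar> \<le> B" "w \<in> borel_measurable borel" "\<And>x. \<bar>w x\<bar> \<le> D"
  shows "conv k (\<lambda>\<eta>. v \<eta> + w \<eta>) y = conv k v y + conv k w y"
  unfolding conv_def distrib_left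
  by (rule Bochner_Integration.integral_add[OF conv_integrable(1)[OF assms(1-3)] conv_integrable(1)[OF assms(1,4,5)]])

text \<open>Bounds the influence at \<open>y\<close> of a unit source beyond \<open>R\<close>;
  integrated over all \<open>y <= R\<close> it stays bounded.\<close>

lemma conv_Ekern_tail_le:
  assumes "y \<le> R" shows "conv Ekern (indicator {R<..}) y \<le> exp (y - R)"
proof -
  have "conv Ekern (indicator {R<..}) y \<le> (LINT x|lborel. indicator {..y-R} x * Ekern x)"
    unfolding conv_commute
  proof (rule integral_mono)
    show "integrable lborel (\<lambda>x. Ekern x * indicator {R<..} (y - x))"
      by (rule conv_integrable(2)[OF Ekern_integrable, where B=1]) (auto simp: indicator_def)
    show "integrable lborel (\<lambda>x. indicator {..y-R} x * Ekern x)"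
      by (rule integrable_indicator_mult[OF Ekern_integrable]) simp
  qed (auto simp: indicator_def Ekern_nonneg)
  also have "\<dots> = Eflux (y - R)"
    using assms by (simp add: Eflux_def Ecdf_def set_lebesgue_integral_def)
  also have "\<dots> \<le> exp (y - R)" using assms by (intro Eflux_nonpos_bounds) simp
  finally show ?thesis .
qed

section \<open>Conserved flux, energy identity and convergence\<close>

locale profile_flux = limit_profile +
  fixes p :: "real \<Rightarrow> real"
  assumes df: "\<And>s. 0 \<le> s \<Longrightarrow> (f has_real_derivative p s) (at s within {0..})"
    and dp: "\<And>s. 0 \<le> s \<Longrightarrow> (p has_real_derivative c * p s + h s) (at s within {0..})"
begin

definition "N = conv Eflux u"
definition "V = conv Epot u"
text \<open>The value at 0 of the conserved quantity \<open>c * f y - N y - p y\<close>.\<close>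

definition "A = c * f 0 - N 0 - p 0"

lemma p_continuous: "continuous_on {0..} p"
  by (rule DERIV_continuous_on[OF dp]) simp

lemma N_abs: "\<bar>N y\<bar> \<le> T ^ 4 * (LINT x|lborel. \<bar>Eflux x\<bar>)"
  unfolding N_def by (rule conv_abs_le[OF Eflux_integrable u_measurable u_bounds(3)])

lemma h_set_integral:
  assumes "0 \<le> a" "a \<le> b"
  shows "(LINT y:{a..b}|lborel. h y) = (LINT y:{a..b}|lborel. u y) - (LINT y:{a..b}|lborel. conv Ekern u y)"
proof -
  have 1: "set_integrable lborel {a..b} u"
    by (rule set_integrable_bounded_Icc[where M="T ^ 4"]) (use u_bounds(3) in \<open>auto simp: set_borel_measurable_def\<close>)
  have 2: "set_integrable lborel {a..b} (conv Ekern u)"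
    by (rule set_integrable_bounded_Icc[where M="T ^ 4"]) (use conv_E_bounds in \<open>auto simp: set_borel_measurable_def\<close>)
  have "(LINT y:{a..b}|lborel. h y) = (LINT y:{a..b}|lborel. u y - conv Ekern u y)"
    unfolding set_lebesgue_integral_def
  proof (intro integral_cong_AE)
    show "(\<lambda>y. indicat_real {a..b} y *\<^sub>R h y) \<in> borel_measurable lborel"
      using h_set_integrable[OF assms(1), of b] by (auto simp: set_integrable_def)
    \<comment> \<open>At the origin \<open>u\<close> is zero by its definition, whereas
      \<open>f 0 ^ 4\<close> need not be.\<close>
    have "AE y in lborel. y \<noteq> (0::real)" by (rule AE_lborel_singleton)
    then show "AE y in lborel. indicat_real {a..b} y *\<^sub>R h y = indicat_real {a..b} y *\<^sub>R (u y - conv Ekern u y)"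
      by eventually_elim (use assms in \<open>auto simp: indicator_def h_def emission_def\<close>)
  qed measurable
  then show ?thesis using set_integral_diff(2)[OF 1 2] by simp
qed

text \<open>Both \<open>p - c f\<close> and \<open>- N\<close> have the increment given by the
  integral of \<open>h\<close>, the first by the equation, the second by
  \<open>conv_Eflux_diff\<close>.\<close>

lemma flux_identity:
  assumes "0 \<le> y" shows "p y = c * f y - N y - A"
proof -
  have "((\<lambda>s. p s - c * f s) has_real_derivative h s) (at s within {0..})" if "0 \<le> s" for s
    by (rule derivative_eq_intros df[OF that] dp[OF that] refl)+ simp
  from has_integral_deriv_atLeast[OF this, of 0 y]
  have "(h has_integral (p y - c * f y) - (p 0 - c * f 0)) {0..y}" using assms by simp
  then have "integral {0..y} h = (p y - c * f y) - (p 0 - c * f 0)" by (rule integral_unique)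
  moreover have "N y - N 0 = - (LINT t:{0..y}|lborel. h t)"
    unfolding N_def conv_Eflux_diff[OF u_measurable u_bounds(3) assms] h_set_integral[OF order_refl assms] by simp
  ultimately show ?thesis
    using set_borel_integral_eq_integral(2)[OF h_set_integrable[OF order_refl], of y] by (simp add: A_def)
qed

lemma potential_identity:
  assumes "0 \<le> a" "a \<le> b"
  shows "((\<lambda>y. c * f y - A) has_integral (f b + V b) - (f a + V a)) {a..b}"
proof -
  have [measurable]: "N \<in> borel_measurable borel"
    unfolding N_def by (intro conv_measurable Eflux_measurable u_measurable)
  have "set_integrable lborel {a..b} N"
    by (rule set_integrable_bounded_Icc[OF _ N_abs]) (simp add: set_borel_measurable_def)
  from set_integral_has_integral[OF this]
  have "(N has_integral V b - V a) {a..b}"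
    by (simp add: V_def N_def conv_Epot_diff[OF u_measurable u_bounds(3) assms(2)])
  with has_integral_deriv_atLeast[OF df assms]
  have "((\<lambda>y. p y + N y) has_integral (f b - f a) + (V b - V a)) {a..b}" by (rule has_integral_add)
  then have "((\<lambda>y. c * f y - A) has_integral (f b - f a) + (V b - V a)) {a..b}"
    by (rule has_integral_eq[rotated]) (use assms flux_identity in auto)
  then show ?thesis by (simp add: algebra_simps)
qed

text \<open>The flux identity expresses \<open>p\<close> through bounded quantities.\<close>

lemma p_bounded: obtains P where "0 \<le> P" "\<And>y. 0 \<le> y \<Longrightarrow> \<bar>p y\<bar> \<le> P"
proof (rule that)
  let ?P = "c * T + T ^ 4 * (LINT x|lborel. \<bar>Eflux x\<bar>) + \<bar>A\<bar>"
  show *: "\<bar>p y\<bar> \<le> ?P" if "0 \<le> y" for y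
  proof -
    have "0 \<le> c * f y" "c * f y \<le> c * T" using f_nonneg[OF that] f_le[OF that] c by auto
    then show ?thesis using flux_identity[OF that] N_abs[of y] by linarith
  qed
  show "0 \<le> ?P" using *[of 0] by linarith
qed

text \<open>Young's inequality bounds the part of \<open>E * u\<close> coming from \<open>[0, R]\<close>; the part beyond \<open>R\<close> costs
  at most \<open>T ^ 5\<close> because the tail of \<open>E\<close> is integrable.\<close>

lemma fh_lower:
  assumes "0 \<le> R"
  shows "- (T ^ 5) \<le> (LINT y:{0..R}|lborel. f y * h y)"
proof -
  have [measurable]: "(\<lambda>y. indicat_real {0..} y *\<^sub>R f y) \<in> borel_measurable borel"
    using fm by (simp add: set_borel_measurable_def)
  \<comment> \<open>The fifth power cut off at \<open>R\<close>, so that its convolution integrates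
    to at most the integral of \<open>f ^ 5\<close> over \<open>{0..R}\<close>.\<close>
  define v where "v = (\<lambda>\<eta>. indicator {0<..R} \<eta> * f \<eta> ^ 5)"
  have "v = (\<lambda>\<eta>. indicator {0<..R} \<eta> * (indicat_real {0..} \<eta> *\<^sub>R f \<eta>) ^ 5)"
    by (auto simp: v_def indicator_def)
  also have "\<dots> \<in> borel_measurable borel" by measurable
  finally have vm [measurable]: "v \<in> borel_measurable borel" .
  have v0: "0 \<le> v x" for x using f_nonneg[of x] by (auto simp: v_def indicator_def)
  have vT: "v x \<le> T ^ 5" for x
    using f_nonneg[of x] f_le[of x] T power_mono[of "f x" T 5] by (auto simp: v_def indicator_def)
  have vabs: "\<bar>v x\<bar> \<le> T ^ 5" for x using v0[of x] vT[of x] by simp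
  have fc: "continuous_on {0..R} f" by (rule continuous_on_subset[OF f_continuous]) auto
  have ci: "set_integrable lborel {0..R} k" if "continuous_on {0..R} k" for k :: "real \<Rightarrow> real"
    using that by (rule borel_integrable_atLeastAtMost')
  have cc: "continuous_on {0..R} (conv Ekern u)" by (rule continuous_on_subset[OF conv_E_continuous]) auto
  have ivc: "set_integrable lborel {0..R} (conv Ekern v)"
    by (rule set_integrable_bounded_Icc[where M="T ^ 5"])
      (use conv_Ekern_bounds[OF vm v0 vT] in \<open>auto simp: set_borel_measurable_def intro: conv_measurable\<close>)
  have pt: "f y * conv Ekern u y \<le> f y ^ 5 / 5 + (4 / 5 * conv Ekern v y + T ^ 5 * exp (y - R))" if y: "y \<in> {0..R}" for y
  proof -
    have f5: "0 \<le> f y" "f y \<le> T" using y f_nonneg[of y] f_le[of y] by auto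
    have f5': "0 \<le> f y ^ 5" "f y ^ 5 \<le> T ^ 5" using f5 by (auto intro: power_mono)
    have im [measurable]: "indicat_real {R<..} \<in> borel_measurable borel" by simp
    have b1: "\<bar>f y ^ 5 / 5\<bar> \<le> 3 * T ^ 5" using f5' by linarith
    have b2: "\<bar>4 / 5 * v \<eta>\<bar> \<le> T ^ 5" for \<eta> using v0[of \<eta>] vT[of \<eta>] by linarith
    have b3: "\<bar>T ^ 5 * indicator {R<..} \<eta>\<bar> \<le> T ^ 5" for \<eta> using T by (auto simp: indicator_def)
    have b4: "\<bar>4 / 5 * v \<eta> + T ^ 5 * indicator {R<..} \<eta>\<bar> \<le> 2 * T ^ 5" for \<eta>
      using b2[of \<eta>] b3[of \<eta>] by linarith
    have uT: "f y * u \<eta> \<le> T ^ 5" for \<eta>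
    proof -
      have "f y * u \<eta> \<le> T * T ^ 4" using f5 u_bounds[of \<eta>] T by (intro mult_mono) auto
      then show ?thesis by (simp add: eval_nat_numeral)
    qed
    have "f y * conv Ekern u y = conv Ekern (\<lambda>\<eta>. f y * u \<eta>) y" by (simp add: conv_scale)
    also have "\<dots> \<le> conv Ekern (\<lambda>\<eta>. f y ^ 5 / 5 + (4 / 5 * v \<eta> + T ^ 5 * indicator {R<..} \<eta>)) y"
    proof (rule conv_mono[OF Ekern_integrable Ekern_nonneg, where B="3 * T ^ 5"])
      fix \<eta>
      have "0 \<le> f y * u \<eta>" using f5 u_bounds(1)[of \<eta>] by simp
      then show "\<bar>f y * u \<eta>\<bar> \<le> 3 * T ^ 5" using uT[of \<eta>] by linarith
      show "\<bar>f y ^ 5 / 5 + (4 / 5 * v \<eta> + T ^ 5 * indicator {R<..} \<eta>)\<bar> \<le> 3 * T ^ 5"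
        using b4[of \<eta>] f5' by linarith
      show "f y * u \<eta> \<le> f y ^ 5 / 5 + (4 / 5 * v \<eta> + T ^ 5 * indicator {R<..} \<eta>)"
      proof -
        \<comment> \<open>Left of 0 there is no source, on \<open>{0<..R}\<close> Young's inequality
          applies, and beyond \<open>R\<close> the crude bound \<open>T ^ 5\<close> is used.\<close>
        consider "\<eta> \<le> 0" | "0 < \<eta>" "\<eta> \<le> R" | "R < \<eta>" by linarith
        then show ?thesis
        proof cases
          case 1
          then show ?thesis using f5' assms by (simp add: emission_def v_def)
        next
          case 2
          then show ?thesis using young_5_4[OF f5(1) f_nonneg[of \<eta>]] by (simp add: emission_def v_def)
        next
          case 3
          then have e: "v \<eta> = 0" "indicat_real {R<..} \<eta> = 1" by (simp_all add: v_def)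
          show ?thesis unfolding e using uT[of \<eta>] f5' by linarith
        qed
      qed
    qed measurable
    also have "\<dots> = conv Ekern (\<lambda>\<eta>. f y ^ 5 / 5) y + conv Ekern (\<lambda>\<eta>. 4 / 5 * v \<eta> + T ^ 5 * indicator {R<..} \<eta>) y"
      by (rule conv_add[OF Ekern_integrable _ b1 _ b4]) measurable
    also have "conv Ekern (\<lambda>\<eta>. 4 / 5 * v \<eta> + T ^ 5 * indicator {R<..} \<eta>) y
        = conv Ekern (\<lambda>\<eta>. 4 / 5 * v \<eta>) y + conv Ekern (\<lambda>\<eta>. T ^ 5 * indicator {R<..} \<eta>) y"
      by (rule conv_add[OF Ekern_integrable _ b2 _ b3]) measurable
    also have "conv Ekern (\<lambda>\<eta>. f y ^ 5 / 5) y = f y ^ 5 / 5" by (simp add: conv_const integral_Ekern)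
    also have "conv Ekern (\<lambda>\<eta>. T ^ 5 * indicator {R<..} \<eta>) y \<le> T ^ 5 * exp (y - R)"
      unfolding conv_scale using conv_Ekern_tail_le[of y R] y T by (intro mult_left_mono) auto
    finally show ?thesis by (simp only: conv_scale)
  qed
  have eR: "(LINT y:{0..R}|lborel. exp (y - R)) \<le> 1"
  proof -
    have "(LINT y:{0..R}|lborel. exp (y - R)) = (LINT y|lborel. exp (y - R) * indicator {0..R} y)"
      by (simp add: set_lebesgue_integral_def mult.commute)
    also have "\<dots> = exp (R - R) - exp (0 - R)"
      by (rule integral_FTC_Icc_real[OF assms]) (auto intro!: derivative_eq_intros continuous_intros)
    finally show ?thesis by simp
  qed
  define S where "S = (LINT y:{0..R}|lborel. f y ^ 5)"
  have vi: "integrable lborel v"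
  proof (rule Bochner_Integration.integrable_bound[OF integrable_indicator_Icc[of 0 R "T ^ 5"]])
    show "AE x in lborel. norm (v x) \<le> norm (indicat_real {0..R} x *\<^sub>R T ^ 5)"
    proof (rule AE_I2)
      fix x
      show "norm (v x) \<le> norm (indicat_real {0..R} x *\<^sub>R T ^ 5)"
        using vabs[of x] T by (cases "x \<in> {0..R}") (simp_all add: v_def)
    qed
  qed measurable
  have vS: "(LINT \<eta>|lborel. v \<eta>) \<le> S"
    unfolding S_def set_lebesgue_integral_def
  proof (rule integral_mono[OF vi])
    show "integrable lborel (\<lambda>y. indicat_real {0..R} y *\<^sub>R f y ^ 5)"
      using ci[of "\<lambda>y. f y ^ 5"] fc by (auto simp: set_integrable_def intro!: continuous_intros)
  qed (use f_nonneg in \<open>auto simp: v_def indicator_def\<close>)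
  \<comment> \<open>After Fubini the mass of the kernel seen from the window is at most one.\<close>
  have "(LINT y:{0..R}|lborel. conv Ekern v y) = (LINT \<eta>|lborel. (LINT y:{0..R}|lborel. Ekern (y - \<eta>)) * v \<eta>)"
    by (rule integral_conv[OF Ekern_integrable vm vabs])
  also have "\<dots> \<le> (LINT \<eta>|lborel. v \<eta>)"
  proof (rule integral_mono'[OF vi])
    fix \<eta>
    have "(LINT y:{0..R}|lborel. Ekern (y - \<eta>)) \<le> (LINT z|lborel. Ekern z)"
      unfolding set_integral_shift[of 0 R Ekern \<eta>] unfolding set_lebesgue_integral_def
      by (rule integral_mono') (auto simp: Ekern_integrable Ekern_nonneg indicator_def)
    then show "(LINT y:{0..R}|lborel. Ekern (y - \<eta>)) * v \<eta> \<le> v \<eta>"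
      using v0[of \<eta>] mult_right_mono[of _ 1 "v \<eta>"] by (simp add: integral_Ekern)
    show "0 \<le> v \<eta>" by (rule v0)
  qed
  finally have cS: "(LINT y:{0..R}|lborel. conv Ekern v y) \<le> S" using vS by linarith
  have i1: "set_integrable lborel {0..R} (\<lambda>y. f y ^ 5)" "set_integrable lborel {0..R} (\<lambda>y. f y * conv Ekern u y)"
      "set_integrable lborel {0..R} (\<lambda>y. exp (y - R))"
    by (intro ci continuous_intros fc cc)+
  have "(LINT y:{0..R}|lborel. f y * conv Ekern u y)
      \<le> (LINT y:{0..R}|lborel. f y ^ 5 / 5 + (4 / 5 * conv Ekern v y + T ^ 5 * exp (y - R)))"
    by (intro set_integral_mono i1 ivc pt set_integral_add(1) set_integrable_mult_right set_integrable_divide)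
  also have "\<dots> = S / 5 + (4 / 5 * (LINT y:{0..R}|lborel. conv Ekern v y) + T ^ 5 * (LINT y:{0..R}|lborel. exp (y - R)))"
    using i1 ivc by (subst set_integral_add(2), (intro set_integral_add(1) set_integrable_mult_right set_integrable_divide; simp)+,
      subst set_integral_add(2), (intro set_integrable_mult_right; simp)+) (simp add: S_def)
  \<comment> \<open>The shares 1/5 and 4/5 add up to exactly \<open>S\<close>, which the integral of
    \<open>f ^ 5\<close> in \<open>f * h\<close> cancels; only the tail \<open>T ^ 5\<close>
    survives.\<close>
  also have "\<dots> \<le> S / 5 + (4 / 5 * S + T ^ 5 * 1)"
    using cS eR T by (intro add_mono mult_left_mono) auto
  finally have "(LINT y:{0..R}|lborel. f y * conv Ekern u y) \<le> S + T ^ 5" by simp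
  moreover have "(LINT y:{0..R}|lborel. f y * h y) = (LINT y:{0..R}|lborel. f y ^ 5 - f y * conv Ekern u y)"
    by (intro set_lebesgue_integral_cong) (auto simp: h_def right_diff_distrib eval_nat_numeral)
  ultimately show ?thesis using set_integral_diff(2)[OF i1(1,2)] by (simp add: S_def)
qed

text \<open>Energy identity: \<open>f p - c f^2 / 2\<close> has derivative \<open>p^2 + f h\<close>.
  The quantity is bounded above because \<open>f\<close> and \<open>p\<close> are bounded, and
  \<open>fh_lower\<close> controls the other term from below.\<close>

lemma p_square_integral_bounded:
  obtains D where "\<And>R. 0 \<le> R \<Longrightarrow> integral {0..R} (\<lambda>y. (p y)\<^sup>2) \<le> D"
proof -
  obtain P where P: "0 \<le> P" "\<And>y. 0 \<le> y \<Longrightarrow> \<bar>p y\<bar> \<le> P" using p_bounded by blast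
  define G where "G = (\<lambda>y. f y * p y - c * (f y)\<^sup>2 / 2)"
  have dG: "(G has_real_derivative (p s)\<^sup>2 + f s * h s) (at s within {0..})" if "0 \<le> s" for s
  proof -
    have "(G has_real_derivative (p s * p s + (c * p s + h s) * f s) - c * (2 * (f s * p s)) / 2) (at s within {0..})"
      unfolding G_def power2_eq_square by (rule derivative_eq_intros df[OF that] dp[OF that] refl | simp; fail)+
    then show ?thesis by (simp add: power2_eq_square algebra_simps)
  qed
  have fp: "\<bar>f y * p y\<bar> \<le> T * P" if "0 \<le> y" for y
    using P(2)[OF that] f_nonneg[OF that] f_le[OF that] T unfolding abs_mult by (intro mult_mono) auto
  show ?thesis
  proof (rule that)
    fix R :: real assume R: "0 \<le> R"
    have ih: "((\<lambda>y. f y * h y) has_integral (LINT y:{0..R}|lborel. f y * h y)) {0..R}"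
      by (intro set_integral_has_integral mult_h_set_integrable continuous_on_subset[OF f_continuous]) auto
    from has_integral_diff[OF has_integral_deriv_atLeast[OF dG order_refl R] ih]
    have "integral {0..R} (\<lambda>y. (p y)\<^sup>2) = G R - G 0 - (LINT y:{0..R}|lborel. f y * h y)"
      by (intro integral_unique) simp
    moreover have "G R \<le> T * P"
    proof -
      have "0 \<le> c * (f R)\<^sup>2 / 2" using c by simp
      then show ?thesis unfolding G_def using fp[OF R] by linarith
    qed
    moreover have "- G 0 \<le> T * P + c * (f 0)\<^sup>2 / 2" unfolding G_def using fp[of 0] by linarith
    ultimately show "integral {0..R} (\<lambda>y. (p y)\<^sup>2) \<le> 2 * (T * P) + c * (f 0)\<^sup>2 / 2 + T ^ 5"
      using fh_lower[OF R] by linarith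
  qed
qed

text \<open>The integral of \<open>p^2\<close> is increasing and bounded, so beyond some
  \<open>Y\<close> it gains at most \<open>\<delta>\<^sup>2\<close>. Pointwise
  \<open>\<bar>p\<bar> <= \<delta> + p^2 / \<delta>\<close>, and over a length of at most 1 each
  summand contributes at most \<delta>, that is \<open>\<epsilon> / 2\<close>.\<close>

lemma f_slowly_varying:
  assumes "0 < \<epsilon>"
  obtains Y where "0 \<le> Y" "\<And>y t. Y \<le> y \<Longrightarrow> 0 \<le> t \<Longrightarrow> t \<le> 1 \<Longrightarrow> \<bar>f (y + t) - f y\<bar> \<le> \<epsilon>"
proof -
  define \<delta> where "\<delta> = \<epsilon> / 2"
  have \<delta>: "0 < \<delta>" using assms by (simp add: \<delta>_def)
  define \<Psi> where "\<Psi> R = integral {0..R} (\<lambda>y. (p y)\<^sup>2)" for R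
  have pi: "(\<lambda>y. (p y)\<^sup>2) integrable_on {a..b}" "p integrable_on {a..b}" if "0 \<le> a" for a b
    using that by (auto intro!: integrable_continuous_real continuous_intros continuous_on_subset[OF p_continuous])
  have \<Psi>_diff: "integral {a..b} (\<lambda>y. (p y)\<^sup>2) = \<Psi> b - \<Psi> a" if "0 \<le> a" "a \<le> b" for a b
    using Henstock_Kurzweil_Integration.integral_combine[OF that pi(1)] by (simp add: \<Psi>_def)
  have \<Psi>_mono: "\<Psi> a \<le> \<Psi> b" if "0 \<le> a" "a \<le> b" for a b
  proof -
    have "0 \<le> integral {a..b} (\<lambda>y. (p y)\<^sup>2)" by (rule integral_nonneg[OF pi(1)[OF that(1)]]) simp
    then show ?thesis using \<Psi>_diff[OF that] by simp
  qed
  obtain D where D: "\<And>R. 0 \<le> R \<Longrightarrow> \<Psi> R \<le> D" using p_square_integral_bounded unfolding \<Psi>_def by blast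
  define L where "L = Sup (\<Psi> ` {0..})"
  have bdd: "bdd_above (\<Psi> ` {0..})" using D by (auto intro!: bdd_aboveI)
  have le_L: "\<Psi> R \<le> L" if "0 \<le> R" for R unfolding L_def using that by (intro cSup_upper bdd) auto
  have "L - \<delta>\<^sup>2 < L" using \<delta> by simp
  then obtain Y where Y: "0 \<le> Y" "L - \<delta>\<^sup>2 < \<Psi> Y"
    unfolding L_def using less_cSup_iff[OF _ bdd] by auto
  have key: "\<bar>f (y + t) - f y\<bar> \<le> \<epsilon>" if y: "Y \<le> y" and t: "0 \<le> t" "t \<le> 1" for y t
  proof -
    have y0: "0 \<le> y" using Y y by simp
    have "norm (integral {y..y+t} p) \<le> integral {y..y+t} (\<lambda>x. \<delta> + (p x)\<^sup>2 / \<delta>)"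
    proof (rule integral_norm_bound_integral)
      show "(\<lambda>x. \<delta> + (p x)\<^sup>2 / \<delta>) integrable_on {y..y+t}"
        using y0 by (intro integrable_add integrable_on_divide pi) auto
      fix x
      show "norm (p x) \<le> \<delta> + (p x)\<^sup>2 / \<delta>"
      proof (cases "\<bar>p x\<bar> \<le> \<delta>")
        case True
        moreover have "0 \<le> (p x)\<^sup>2 / \<delta>" using \<delta> by simp
        ultimately show ?thesis unfolding real_norm_def by linarith
      next
        case False
        then have "\<bar>p x\<bar> * \<delta> \<le> \<bar>p x\<bar> * \<bar>p x\<bar>" by (intro mult_left_mono) auto
        then have "\<bar>p x\<bar> \<le> (p x)\<^sup>2 / \<delta>" using \<delta> by (simp add: field_simps power2_eq_square)
        then show ?thesis using \<delta> by simp
      qed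
    qed (use pi y0 in auto)
    also have "integral {y..y+t} (\<lambda>x. \<delta> + (p x)\<^sup>2 / \<delta>) = t * \<delta> + (\<Psi> (y + t) - \<Psi> y) / \<delta>"
      using y0 t \<Psi>_diff[of y "y+t"] by (subst Henstock_Kurzweil_Integration.integral_add)
        (auto intro!: integrable_on_divide pi)
    also have "\<dots> \<le> 1 * \<delta> + \<delta>\<^sup>2 / \<delta>"
    proof (intro add_mono mult_right_mono divide_right_mono)
      have "\<Psi> Y \<le> \<Psi> y" using \<Psi>_mono[of Y y] Y y by simp
      then show "\<Psi> (y + t) - \<Psi> y \<le> \<delta>\<^sup>2" using le_L[of "y + t"] Y(2) y0 t by simp
    qed (use t \<delta> in auto)
    also have "\<dots> = \<epsilon>" using \<delta> by (simp add: \<delta>_def power2_eq_square)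
    finally have "\<bar>integral {y..y+t} p\<bar> \<le> \<epsilon>" by simp
    moreover have "integral {y..y+t} p = f (y + t) - f y"
      by (rule integral_unique[OF has_integral_deriv_atLeast[OF df]]) (use y0 t in auto)
    ultimately show ?thesis by simp
  qed
  show ?thesis by (rule that[OF Y(1) key])
qed

lemma f_shift_tendsto: "((\<lambda>y. f (y + 1) - f y) \<longlongrightarrow> 0) at_top"
proof (rule tendstoI)
  fix e :: real assume "0 < e"
  then obtain Y where "\<And>y t. Y \<le> y \<Longrightarrow> 0 \<le> t \<Longrightarrow> t \<le> 1 \<Longrightarrow> \<bar>f (y + t) - f y\<bar> \<le> e / 2"
    using f_slowly_varying[of "e / 2"] by (metis half_gt_zero)
  then have "\<bar>f (y + 1) - f y\<bar> < e" if "Y \<le> y" for y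
    using that \<open>0 < e\<close> by (metis field_sum_of_halves le_less_trans less_add_same_cancel1 half_gt_zero order_refl zero_le_one)
  then show "\<forall>\<^sub>F y in at_top. dist (f (y + 1) - f y) 0 < e"
    unfolding eventually_at_top_linorder dist_real_def by (intro exI[of _ Y]) simp
qed

lemma u_shift_tendsto: "((\<lambda>y. u (y + 1) - u y) \<longlongrightarrow> 0) at_top"
proof (rule Lim_null_comparison)
  show "((\<lambda>y. \<bar>f (y + 1) - f y\<bar> * (2 * T * (2 * T\<^sup>2))) \<longlongrightarrow> 0) at_top"
    by (rule tendsto_mult_left_zero) (rule tendsto_rabs_zero[OF f_shift_tendsto])
  show "\<forall>\<^sub>F y in at_top. norm (u (y + 1) - u y) \<le> \<bar>f (y + 1) - f y\<bar> * (2 * T * (2 * T\<^sup>2))"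
    using eventually_gt_at_top[of 0]
  proof eventually_elim
    case (elim y)
    define a b where "a = f (y + 1)" and "b = f y"
    have ab: "0 \<le> a" "a \<le> T" "0 \<le> b" "b \<le> T"
      using f_nonneg[of "y+1"] f_nonneg[of y] f_le[of "y+1"] f_le[of y] elim by (auto simp: a_def b_def)
    have "u (y + 1) - u y = a ^ 4 - b ^ 4" using elim by (simp add: emission_def a_def b_def)
    also have "\<dots> = (a - b) * ((a + b) * (a\<^sup>2 + b\<^sup>2))" by algebra
    finally have "norm (u (y + 1) - u y) = \<bar>a - b\<bar> * ((a + b) * (a\<^sup>2 + b\<^sup>2))"
      using ab by (simp add: abs_mult)
    also have "\<dots> \<le> \<bar>a - b\<bar> * ((2 * T) * (2 * T\<^sup>2))"
    proof (intro mult_left_mono mult_mono)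
      have "a\<^sup>2 \<le> T\<^sup>2" "b\<^sup>2 \<le> T\<^sup>2" using ab by (auto intro: power_mono)
      then show "a\<^sup>2 + b\<^sup>2 \<le> 2 * T\<^sup>2" by linarith
    qed (use ab in auto)
    finally show ?case by (simp add: a_def b_def)
  qed
qed

text \<open>For fixed \<open>x\<close> the argument \<open>y - x\<close> tends to infinity with
  \<open>y\<close>; integrability of \<open>Epot\<close> supplies the dominating function.\<close>

lemma conv_Epot_tendsto:
  assumes [measurable]: "w \<in> borel_measurable borel" and b: "\<And>x. \<bar>w x\<bar> \<le> B" and lim: "(w \<longlongrightarrow> 0) at_top"
  shows "((\<lambda>y. conv Epot w y) \<longlongrightarrow> 0) at_top"
proof -
  have "((\<lambda>y. LINT x|lborel. Epot x * w (y - x)) \<longlongrightarrow> (LINT x::real|lborel. 0)) at_top"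
  proof (rule integral_dominated_convergence_at_top[where f="\<lambda>x. 0" and s="\<lambda>y x. Epot x * w (y - x)" and w="\<lambda>x. Epot x * B"])
    show "integrable lborel (\<lambda>x. Epot x * B)" by (intro integrable_mult_left Epot_integrable)
    show "\<forall>\<^sub>F y in at_top. AE x in lborel. norm (Epot x * w (y - x)) \<le> Epot x * B"
      using b Epot_nonneg by (intro always_eventually allI AE_I2) (auto simp: abs_mult intro!: mult_left_mono)
    show "AE x in lborel. ((\<lambda>y. Epot x * w (y - x)) \<longlongrightarrow> 0) at_top"
    proof (rule AE_I2)
      fix x :: real
      have "filterlim (\<lambda>y. y - x) at_top at_top"
        using filterlim_tendsto_add_at_top[OF tendsto_const[of "-x"] filterlim_ident] by simp
      then show "((\<lambda>y. Epot x * w (y - x)) \<longlongrightarrow> 0) at_top"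
        by (intro tendsto_mult_right_zero filterlim_compose[OF lim])
    qed
  qed measurable
  then show ?thesis by (simp add: conv_commute)
qed

text \<open>A shift commutes with convolution, so the increment of \<open>V\<close> is the potential
  of the increment of \<open>u\<close>.\<close>

lemma V_shift_tendsto: "((\<lambda>y. V (y + 1) - V y) \<longlongrightarrow> 0) at_top"
proof -
  have s: "(\<lambda>y. u (y + 1)) \<in> borel_measurable borel" by measurable
  have "V (y + 1) - V y = conv Epot (\<lambda>z. u (z + 1) - u z) y" for y
  proof -
    have "conv Epot (\<lambda>z. u (z + 1) - u z) y = (LINT x|lborel. Epot x * u (y + 1 - x) - Epot x * u (y - x))"
      unfolding conv_commute by (simp add: right_diff_distrib algebra_simps)
    also have "\<dots> = V (y + 1) - V y"
      unfolding V_def conv_commute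
      by (intro Bochner_Integration.integral_diff conv_integrable(2)[OF Epot_integrable u_measurable u_bounds(3)])
    finally show ?thesis ..
  qed
  moreover have "((\<lambda>y. conv Epot (\<lambda>z. u (z + 1) - u z) y) \<longlongrightarrow> 0) at_top"
  proof (rule conv_Epot_tendsto[OF _ _ u_shift_tendsto])
    show "\<bar>u (z + 1) - u z\<bar> \<le> 2 * T ^ 4" for z
      using u_bounds[of z] u_bounds[of "z + 1"] by linarith
  qed measurable
  ultimately show ?thesis by simp
qed

lemma f_tendsto: "(f \<longlongrightarrow> A / c) at_top"
proof -
  have "((\<lambda>y. c * f y - A) \<longlongrightarrow> 0) at_top"
  proof (rule tendstoI)
    fix e :: real assume e: "0 < e"
    \<comment> \<open>Three errors of \<open>e / 4\<close> must stay below \<open>e\<close>: the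
      oscillation of \<open>c * f\<close> on the unit interval and the increments of
      \<open>f\<close> and of \<open>V\<close>.\<close>
    define \<epsilon> where "\<epsilon> = e / (4 * c)"
    have \<epsilon>: "0 < \<epsilon>" "c * \<epsilon> = e / 4" using e c by (auto simp: \<epsilon>_def)
    obtain Y where Y: "0 \<le> Y" "\<And>y t. Y \<le> y \<Longrightarrow> 0 \<le> t \<Longrightarrow> t \<le> 1 \<Longrightarrow> \<bar>f (y + t) - f y\<bar> \<le> \<epsilon>"
      using f_slowly_varying[OF \<epsilon>(1)] by blast
    have "\<forall>\<^sub>F y in at_top. \<bar>f (y + 1) - f y\<bar> < e / 4" "\<forall>\<^sub>F y in at_top. \<bar>V (y + 1) - V y\<bar> < e / 4"
      using tendstoD[OF f_shift_tendsto, of "e / 4"] tendstoD[OF V_shift_tendsto, of "e / 4"] e by (simp_all add: dist_real_def)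
    then show "\<forall>\<^sub>F y in at_top. dist (c * f y - A) 0 < e"
      using eventually_ge_at_top[of Y]
    proof eventually_elim
      case (elim y)
      have y0: "0 \<le> y" using Y elim by simp
      have "((\<lambda>t. c * f t - A) has_integral (f (y + 1) + V (y + 1)) - (f y + V y)) {y..y+1}"
        by (rule potential_identity) (use y0 in auto)
      moreover have "((\<lambda>t. c * f y - A) has_integral c * f y - A) {y..y+1}"
        using has_integral_const_real[of "c * f y - A" y "y+1"] by simp
      ultimately have "((\<lambda>t. (c * f t - A) - (c * f y - A)) has_integral
          ((f (y + 1) + V (y + 1)) - (f y + V y)) - (c * f y - A)) {y..y+1}"
        by (rule has_integral_diff)
      then have "norm (((f (y + 1) + V (y + 1)) - (f y + V y)) - (c * f y - A)) \<le> (c * \<epsilon>) * measure lborel {y..y+1}"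
      proof (rule has_integral_bound_real[where S="{}", rotated 2])
        fix t assume "t \<in> {y..y+1} - {}"
        then have t: "t \<in> {y..y+1}" by simp
        have "\<bar>f t - f y\<bar> \<le> \<epsilon>" using Y(2)[of y "t - y"] t elim by simp
        then have "c * \<bar>f t - f y\<bar> \<le> c * \<epsilon>" using c by simp
        moreover have "norm ((c * f t - A) - (c * f y - A)) = c * \<bar>f t - f y\<bar>"
          using c by (simp add: right_diff_distrib[symmetric] abs_mult)
        ultimately show "norm ((c * f t - A) - (c * f y - A)) \<le> c * \<epsilon>" by simp
      qed (use \<epsilon> e in auto)
      then have "\<bar>((f (y + 1) + V (y + 1)) - (f y + V y)) - (c * f y - A)\<bar> \<le> e / 4" using \<epsilon> by simp
      then have "\<bar>c * f y - A\<bar> < e" using elim(1,2) e by linarith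
      then show ?case by (simp add: dist_real_def)
    qed
  qed
  then have "((\<lambda>y. (c * f y - A + A) / c) \<longlongrightarrow> (0 + A) / c) at_top"
    using c by (intro tendsto_intros) auto
  then show ?thesis using c by simp
qed

lemma V_nonneg: "0 \<le> V y"
  unfolding V_def conv_def using Epot_nonneg u_bounds(1) by (intro Bochner_Integration.integral_nonneg) auto

lemma A_pos: "0 < A"
proof -
  have "\<forall>\<^sub>F y in at_top. 0 \<le> f y"
    by (rule eventually_mono[OF eventually_ge_at_top[of 0]]) (rule f_nonneg)
  then have "0 \<le> A / c" by (rule tendsto_lowerbound[OF f_tendsto]) simp
  then have "0 \<le> A" using c by (simp add: zero_le_divide_iff)
  moreover have "A \<noteq> 0"
  proof
    assume A: "A = 0"
    have f: "(f \<longlongrightarrow> 0) at_top" using f_tendsto A by simp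
    have "((\<lambda>y. f y ^ 4) \<longlongrightarrow> 0 ^ 4) at_top" by (intro tendsto_intros f)
    moreover have "\<forall>\<^sub>F y in at_top. f y ^ 4 = u y"
      using eventually_gt_at_top[of 0] by eventually_elim (simp add: emission_def)
    ultimately have "(u \<longlongrightarrow> 0) at_top" using tendsto_cong by force
    then have "((\<lambda>y. f y + V y) \<longlongrightarrow> 0 + 0) at_top"
      unfolding V_def by (intro tendsto_add f conv_Epot_tendsto[OF u_measurable u_bounds(3)])
    moreover have "T \<le> f y + V y" if "0 \<le> y" for y
    proof -
      have "0 \<le> (f y + V y) - (f 0 + V 0)"
        by (rule has_integral_nonneg[OF potential_identity[OF order_refl that]]) (use c A f_nonneg in auto)
      \<comment> \<open>With pole \<open>s = 0\<close> both \<open>kap\<close> and the Green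
        function vanish, and the equation reduces to the boundary condition.\<close>
      moreover have "f 0 = T" using green[of 1 0] c by (simp add: kap_def green_def ramp_def set_lebesgue_integral_def)
      ultimately show ?thesis using V_nonneg[of 0] by linarith
    qed
    then have "\<forall>\<^sub>F y in at_top. T \<le> f y + V y" by (rule eventually_mono[OF eventually_ge_at_top[of 0]])
    ultimately have "T \<le> 0 + 0" by (intro tendsto_lowerbound[where F=at_top]) auto
    then show False using T by simp
  qed
  ultimately show ?thesis by simp
qed

end

theorem theorem3p8:
  fixes TM c :: real and fs :: "nat \<Rightarrow> real \<Rightarrow> real" and f :: "real \<Rightarrow> real"
  assumes "TM > 0" and "c > 0"
    and "fs 0 = (\<lambda>y. 0)"
    and "\<And>n. is_minimizer c TM (gsrc (fs n)) (fs (Suc n))"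
    and "\<And>y. y \<ge> 0 \<Longrightarrow> (\<lambda>n. fs n y) \<longlonglongrightarrow> f y"
  shows "\<exists>finf. (f \<longlongrightarrow> finf) at_top \<and> finf > 0"
proof -
  interpret limit_profile c TM f
    using assms(1,2) limit_green_equation[OF assms] by unfold_locales
  obtain p where "\<And>s. 0 \<le> s \<Longrightarrow> (f has_real_derivative p s) (at s within {0..})"
    "\<And>s. 0 \<le> s \<Longrightarrow> (p has_real_derivative c * p s + h s) (at s within {0..})"
    using profile_ode by blast
  then interpret profile_flux c TM f p by unfold_locales
  show ?thesis using f_tendsto A_pos c by (intro exI[of _ "A / c"]) simp
qed

end
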